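(* Let $(S,N,Z)$ be a structured semigroup such that $Z$ is symmetric. Then the directed coset representation $\mathcal{D}:a\mapsto\mathcal{D}_a=\{D\in\mathcal{D}(S):a\in D\}$ is a Zakrzewski-universal étale representation of $(S,N,Z)$ (on the étale groupoid $\mathcal{D}(S)$).
   Context: A structured semigroup $(S,N,Z)$ consists of a semigroup $S$, a subsemigroup $N$ of $S$ and a subsemigroup $Z$ of $S$ with $Z\subseteq\mathsf{Z}(N)=\{z\in N:\forall n\in N\ (nz=zn)\}$, such that: (i) for all $a,b\in S$, $ab,ba\in Z$ implies $aZb\cup bZa\subseteq Z$; (ii) for all $a,b\in S$ and $n\in N$, if $abn=n=nab$ and $ab,ba\in Z$ then $bna\in N$. $Z$ is symmetric if for all $a,b\in S$, $ab\in Z$ implies $baba\in Z$. For $a,s,b\in S$: $a<_sb$ means $asb=a=bsa$, $as,sa\in N$ and $bs,sb\in Z$; $a<b$ means $a<_sb$ for some $s\in S$. For $A,B\subseteq S$: $AB=\{ab:a\in A,b\in B\}$, $A^<=\{b\in S:\exists a\in A\ (a<b)\}$ and $A^*=\{s\in S:\exists a\in A\,\exists b\in S\ (a<_sb)\}$. A coset is a $C\subseteq S$ with $CC^*C\subseteq C=C^<$. $\mathcal{C}(S)$ is the set of non-empty cosets; with $\mathsf{s}(C)=(C^*C)^<$ and $\mathsf{r}(C)=(CC^* )^<$, it is an étale groupoid with inverse $C\mapsto C^*$, product $B\cdot C=(BC)^<$ defined when $\mathsf{s}(B)=\mathsf{r}(C)$, and the topology with subbasis $\mathcal{C}_a=\{C\in\mathcal{C}(S):a\in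 C\}$, $a\in S$. A subset $D\subseteq S$ is directed if for all $a,b\in D$ there is $d\in D$ with $d<a$ and $d<b$. $\mathcal{D}(S)=\{D\in\mathcal{C}(S):D\text{ is directed}\}$, an étale subgroupoid of $\mathcal{C}(S)$ with the subspace topology. Groupoids: $G^0$ is the set of units of $G$, $\mathsf{s}(g)=g^{-1}g$, $\mathsf{r}(g)=gg^{-1}$, $gh$ is defined iff $\mathsf{s}(g)=\mathsf{r}(h)$. A slice is a subset on which $\mathsf{s}$ and $\mathsf{r}$ are injective. A topological groupoid (continuous inverse and product) is étale if $\mathsf{s}$ maps open subsets of $G$ to open subsets of $G$; no Hausdorff assumptions. $\mathcal{O}(X)$ denotes the open subsets of $X$ and $\mathcal{B}(G)$ the semigroup of open slices of $G$ under $AB=\{ab:a\in A,b\in B,\ ab\text{ defined}\}$. An étale representation of $(S,N,Z)$ on an étale groupoid $G$ is a semigroup homomorphism $\theta:S\to\mathcal{B}(G)$ such that $\bigcup_{a\in S}\theta(a)=G$, $\theta[N]\subseteq\mathcal{O}(G^0)$ and, for all $g\in G$ and $a\in S$, $g\in\theta(a)$ implies $g\in\theta(b)$ for some $b<a$. A relation $\phi\subseteq G\times H$ between groupoids is viewed as going from $H$ to $G$, with $\phi^{-1}[G']=\{h\in H:\exists g\in G'\,(g\mathrel\phi h)\}$. It is functorial if $g\mathrel\phi h$ implies $g^{-1}\mathrel\phi h^{-1}$, and $g\mathrel\phi h$, $g'\mathrel\phi h'$, $\mathsf{s}(h)=\mathsf{r}(h')$ imply $\mathsf{s}(g)=\mathsf{r}(g')$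 and $gg'\mathrel\phi hh'$. A functorial $\phi$ is star-bijective if whenever $\mathsf{r}(g)\mathrel\phi h\in H^0$ there is precisely one $i\in H$ with $\mathsf{r}(i)=h$ and $g\mathrel\phi i$. A Zakrzewski morphism $\phi\subseteq G\times H$ between étale groupoids is a star-bijective functorial relation with $\phi^{-1}[O]$ open for all open $O\subseteq G$; it induces $\overline\phi:\mathcal{B}(G)\to\mathcal{B}(H)$, $\overline\phi(O)=\phi^{-1}[O]$. An étale representation $\mu:S\to\mathcal{B}(G)$ is Zakrzewski-universal if for every étale representation $\theta:S\to\mathcal{B}(H)$ (on any étale groupoid $H$) there is a unique Zakrzewski morphism $\phi\subseteq G\times H$ with $\theta=\overline\phi\circ\mu$. *)

theory Defs
  imports "HOL-Analysis.Analysis" "HOL-Library.Set_Algebras"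
begin

section \<open>Etale groupoids\<close>

text \<open>The multiplication is a total function, but only its values on composable pairs of arrows
  are meaningful; everything is relativised to the arrow set, which may be empty.\<close>

record 'g groupoid =
  arrows :: "'g set"
  gmult :: "'g \<Rightarrow> 'g \<Rightarrow> 'g"
  ginv :: "'g \<Rightarrow> 'g"

record 'g top_groupoid = "'g groupoid" +
  gtop :: "'g topology"

definition src :: "('g, 'm) groupoid_scheme \<Rightarrow> 'g \<Rightarrow> 'g" where
  "src G g = gmult G (ginv G g) g"

definition rng :: "('g, 'm) groupoid_scheme \<Rightarrow> 'g \<Rightarrow> 'g" where
  "rng G g = gmult G g (ginv G g)"

definition units :: "('g, 'm) groupoid_scheme \<Rightarrow> 'g set" where
  "units G = src G ` arrows G"

definition composable :: "('g, 'm) groupoid_scheme \<Rightarrow> ('g \<times> 'g) set" where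
  "composable G = {(g, h). g \<in> arrows G \<and> h \<in> arrows G \<and> src G g = rng G h}"

text \<open>Small categories with all arrows invertible, in arrows-only form.\<close>

definition is_groupoid :: "('g, 'm) groupoid_scheme \<Rightarrow> bool" where
  "is_groupoid G \<longleftrightarrow>
    (\<forall>g \<in> arrows G. ginv G g \<in> arrows G \<and> ginv G (ginv G g) = g) \<and>
    (\<forall>g h. (g, h) \<in> composable G \<longrightarrow>
       gmult G g h \<in> arrows G \<and> src G (gmult G g h) = src G h \<and> rng G (gmult G g h) = rng G g) \<and>
    (\<forall>g h k. (g, h) \<in> composable G \<and> (h, k) \<in> composable G \<longrightarrow>
       gmult G (gmult G g h) k = gmult G g (gmult G h k)) \<and>
    (\<forall>g \<in> arrows G. gmult G (rng G g) g = g \<and> gmult G g (src G g) = g)"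

definition topological_groupoid :: "'g top_groupoid \<Rightarrow> bool" where
  "topological_groupoid G \<longleftrightarrow>
    is_groupoid G \<and>
    topspace (gtop G) = arrows G \<and>
    continuous_map (gtop G) (gtop G) (ginv G) \<and>
    continuous_map (subtopology (prod_topology (gtop G) (gtop G)) (composable G)) (gtop G)
      (\<lambda>(g, h). gmult G g h)"

definition etale_groupoid :: "'g top_groupoid \<Rightarrow> bool" where
  "etale_groupoid G \<longleftrightarrow>
    topological_groupoid G \<and> (\<forall>U. openin (gtop G) U \<longrightarrow> openin (gtop G) (src G ` U))"

definition slice :: "('g, 'm) groupoid_scheme \<Rightarrow> 'g set \<Rightarrow> bool" where
  "slice G A \<longleftrightarrow> A \<subseteq> arrows G \<and> inj_on (src G) A \<and> inj_on (rng G) A"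

definition open_slices :: "'g top_groupoid \<Rightarrow> 'g set set" where
  "open_slices G = {A. openin (gtop G) A \<and> slice G A}"

definition slice_mult :: "('g, 'm) groupoid_scheme \<Rightarrow> 'g set \<Rightarrow> 'g set \<Rightarrow> 'g set" where
  "slice_mult G A B = {gmult G a b | a b. a \<in> A \<and> b \<in> B \<and> (a, b) \<in> composable G}"


section \<open>Structured semigroups\<close>

text \<open>The semigroup \<open>S\<close> is the whole type \<open>'a\<close>. Subsemigroups may be empty.\<close>

definition subsemigroup :: "'a::semigroup_mult set \<Rightarrow> bool" where
  "subsemigroup A \<longleftrightarrow> (\<forall>a \<in> A. \<forall>b \<in> A. a * b \<in> A)"

definition center :: "'a::semigroup_mult set \<Rightarrow> 'a set" where
  "center N = {z \<in> N. \<forall>n \<in> N. n * z = z * n}"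

definition structured_semigroup :: "'a::semigroup_mult set \<Rightarrow> 'a set \<Rightarrow> bool" where
  "structured_semigroup N Z \<longleftrightarrow>
    subsemigroup N \<and> subsemigroup Z \<and> Z \<subseteq> center N \<and>
    (\<forall>a b. a * b \<in> Z \<and> b * a \<in> Z \<longrightarrow>
       (\<lambda>z. a * z * b) ` Z \<union> (\<lambda>z. b * z * a) ` Z \<subseteq> Z) \<and>
    (\<forall>a b. \<forall>n \<in> N. a * b * n = n \<and> n = n * a * b \<and> a * b \<in> Z \<and> b * a \<in> Z \<longrightarrow>
       b * n * a \<in> N)"

definition symmetric :: "'a::semigroup_mult set \<Rightarrow> bool" where
  "symmetric Z \<longleftrightarrow> (\<forall>a b. a * b \<in> Z \<longrightarrow> b * a * b * a \<in> Z)"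

text \<open>\<open>domin_via N Z s a b\<close> is the relation \<open>a <\<^sub>s b\<close>, and \<open>domin N Z a b\<close> is \<open>a < b\<close>.\<close>

definition domin_via :: "'a::semigroup_mult set \<Rightarrow> 'a set \<Rightarrow> 'a \<Rightarrow> 'a \<Rightarrow> 'a \<Rightarrow> bool" where
  "domin_via N Z s a b \<longleftrightarrow>
    a * s * b = a \<and> a = b * s * a \<and> a * s \<in> N \<and> s * a \<in> N \<and> b * s \<in> Z \<and> s * b \<in> Z"

definition domin :: "'a::semigroup_mult set \<Rightarrow> 'a set \<Rightarrow> 'a \<Rightarrow> 'a \<Rightarrow> bool" where
  "domin N Z a b \<longleftrightarrow> (\<exists>s. domin_via N Z s a b)"

definition up :: "'a::semigroup_mult set \<Rightarrow> 'a set \<Rightarrow> 'a set \<Rightarrow> 'a set" where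
  "up N Z A = {b. \<exists>a \<in> A. domin N Z a b}"

definition star :: "'a::semigroup_mult set \<Rightarrow> 'a set \<Rightarrow> 'a set \<Rightarrow> 'a set" where
  "star N Z A = {s. \<exists>a \<in> A. \<exists>b. domin_via N Z s a b}"

text \<open>Products of subsets are those of \<^theory>\<open>HOL-Library.Set_Algebras\<close>.\<close>

definition coset :: "'a::semigroup_mult set \<Rightarrow> 'a set \<Rightarrow> 'a set \<Rightarrow> bool" where
  "coset N Z C \<longleftrightarrow> C * star N Z C * C \<subseteq> C \<and> C = up N Z C"

definition cosets :: "'a::semigroup_mult set \<Rightarrow> 'a set \<Rightarrow> 'a set set" where
  "cosets N Z = {C. coset N Z C \<and> C \<noteq> {}}"

definition directed :: "'a::semigroup_mult set \<Rightarrow> 'a set \<Rightarrow> 'a set \<Rightarrow> bool" where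
  "directed N Z D \<longleftrightarrow> (\<forall>a \<in> D. \<forall>b \<in> D. \<exists>d \<in> D. domin N Z d a \<and> domin N Z d b)"

definition directed_cosets :: "'a::semigroup_mult set \<Rightarrow> 'a set \<Rightarrow> 'a set set" where
  "directed_cosets N Z = {D \<in> cosets N Z. directed N Z D}"

definition coset_groupoid :: "'a::semigroup_mult set \<Rightarrow> 'a set \<Rightarrow> 'a set top_groupoid" where
  "coset_groupoid N Z =
    \<lparr>arrows = cosets N Z,
     gmult = (\<lambda>B C. up N Z (B * C)),
     ginv = star N Z,
     gtop = topology_generated_by (range (\<lambda>a. {C \<in> cosets N Z. a \<in> C}))\<rparr>"

definition directed_coset_groupoid :: "'a::semigroup_mult set \<Rightarrow> 'a set \<Rightarrow> 'a set top_groupoid" where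
  "directed_coset_groupoid N Z =
    coset_groupoid N Z
      \<lparr>arrows := directed_cosets N Z,
       gtop := subtopology (gtop (coset_groupoid N Z)) (directed_cosets N Z)\<rparr>"

definition directed_coset_rep :: "'a::semigroup_mult set \<Rightarrow> 'a set \<Rightarrow> 'a \<Rightarrow> 'a set set" where
  "directed_coset_rep N Z a = {D \<in> directed_cosets N Z. a \<in> D}"


section \<open>Etale representations and Zakrzewski morphisms\<close>

definition etale_representation ::
  "'a::semigroup_mult set \<Rightarrow> 'a set \<Rightarrow> 'g top_groupoid \<Rightarrow> ('a \<Rightarrow> 'g set) \<Rightarrow> bool" where
  "etale_representation N Z G \<theta> \<longleftrightarrow>
    etale_groupoid G \<and>
    range \<theta> \<subseteq> open_slices G \<and>
    (\<forall>a b. \<theta> (a * b) = slice_mult G (\<theta> a) (\<theta> b)) \<and>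
    (\<Union>a. \<theta> a) = arrows G \<and>
    (\<forall>n \<in> N. openin (subtopology (gtop G) (units G)) (\<theta> n)) \<and>
    (\<forall>g \<in> arrows G. \<forall>a. g \<in> \<theta> a \<longrightarrow> (\<exists>b. domin N Z b a \<and> g \<in> \<theta> b))"

text \<open>A relation \<open>\<phi> \<subseteq> G \<times> H\<close> is a set of pairs, so \<open>\<phi>\<inverse>[A]\<close> is the relational image \<open>\<phi> `` A\<close>.\<close>

definition functorial ::
  "('g, 'm) groupoid_scheme \<Rightarrow> ('h, 'n) groupoid_scheme \<Rightarrow> ('g \<times> 'h) set \<Rightarrow> bool" where
  "functorial G H \<phi> \<longleftrightarrow>
    \<phi> \<subseteq> arrows G \<times> arrows H \<and>
    (\<forall>g h. (g, h) \<in> \<phi> \<longrightarrow> (ginv G g, ginv H h) \<in> \<phi>) \<and>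
    (\<forall>g h g' h'. (g, h) \<in> \<phi> \<and> (g', h') \<in> \<phi> \<and> src H h = rng H h' \<longrightarrow>
       src G g = rng G g' \<and> (gmult G g g', gmult H h h') \<in> \<phi>)"

definition star_bijective ::
  "('g, 'm) groupoid_scheme \<Rightarrow> ('h, 'n) groupoid_scheme \<Rightarrow> ('g \<times> 'h) set \<Rightarrow> bool" where
  "star_bijective G H \<phi> \<longleftrightarrow>
    (\<forall>g \<in> arrows G. \<forall>h \<in> units H. (rng G g, h) \<in> \<phi> \<longrightarrow>
       (\<exists>!i. i \<in> arrows H \<and> rng H i = h \<and> (g, i) \<in> \<phi>))"

definition zakrzewski_morphism ::
  "'g top_groupoid \<Rightarrow> 'h top_groupoid \<Rightarrow> ('g \<times> 'h) set \<Rightarrow> bool" where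
  "zakrzewski_morphism G H \<phi> \<longleftrightarrow>
    functorial G H \<phi> \<and> star_bijective G H \<phi> \<and>
    (\<forall>U. openin (gtop G) U \<longrightarrow> openin (gtop H) (\<phi> `` U))"

text \<open>A formula cannot quantify over types, so the type of arrows of the test groupoids \<open>H\<close> is a
  parameter; theorems about the predicate are stated for arbitrary \<open>'h\<close>.\<close>

definition zakrzewski_universal ::
  "'h itself \<Rightarrow> 'a::semigroup_mult set \<Rightarrow> 'a set \<Rightarrow> 'g top_groupoid \<Rightarrow> ('a \<Rightarrow> 'g set) \<Rightarrow> bool" where
  "zakrzewski_universal (_ :: 'h itself) N Z G \<mu> \<longleftrightarrow>
    etale_representation N Z G \<mu> \<and>
    (\<forall>(H :: 'h top_groupoid) \<theta>. etale_representation N Z H \<theta> \<longrightarrow>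
       (\<exists>!\<phi>. zakrzewski_morphism G H \<phi> \<and> \<theta> = (\<lambda>U. \<phi> `` U) \<circ> \<mu>))"

end

theory Submission imports Defs begin

text \<open>Think of \<open>S\<close> as a semigroup of sections supported on open slices, with \<open>N\<close> the sections
living on the units. A relation \<open>a <\<^sub>s b\<close> then says that \<open>s\<close> inverts \<open>b\<close> on the support of \<open>a\<close>: the
products \<open>bs\<close> and \<open>sb\<close> are in \<open>Z\<close> and act as identities on \<open>a\<close>. A directed coset is the family of
sections that are invertible at an (ideal) arrow, or more generally near a common closed set of
arrows; a coset differs from an arbitrary filter in being closed under \<open>(a, s, b) \<mapsto> asb\<close> for
inverses \<open>s\<close> of its elements.

\<^bold>\<open>The groupoid.\<close> The arithmetic of domination yields \<open>Star (Star C) = C\<close> and, for cosets with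
matching source and range, \<open>Star (Up (B * C)) = Up (Star C * Star B)\<close> (\<open>coset_Star_dominated\<close>,
\<open>Star_mult_subset\<close>). After that the groupoid laws are an equational calculation with set products,
because \<open>Up\<close> can be dropped inside \<open>Up (A * B)\<close> for rounded sets.

\<^bold>\<open>The representation.\<close> A directed coset is determined by its source (or its range) and any one of
its elements, so the sets \<open>rep a\<close> are slices, and a directed coset containing an element of \<open>N\<close> is
a unit. The one delicate point is \<open>rep (a * b) \<subseteq> rep a \<cdot> rep b\<close>: if \<open>d <\<^sub>s ab\<close>, then \<open>bs\<close> is only a
one-sided inverse of \<open>a\<close> as far as \<open>Z\<close> is concerned. Symmetry of \<open>Z\<close> repairs this, as it makes
\<open>bsabs\<close> a two-sided one (\<open>domv_factor_left\<close>, \<open>directed_coset_factor\<close>). Openness of the source map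
follows from the same factorisation.

\<^bold>\<open>Universality.\<close> Given a representation \<open>\<theta>\<close> on \<open>H\<close> and an arrow \<open>h\<close>, the set \<open>germs h\<close> of all \<open>a\<close>
with \<open>h \<in> \<theta> a\<close> need be neither directed nor a coset, and different directed cosets may lie inside
it. The classifying relation relates \<open>D\<close> to \<open>h\<close> when \<open>D \<subseteq> germs h\<close> and the range of \<open>D\<close> contains
every \<open>n \<in> N\<close> with \<open>rng h \<in> \<theta> n\<close>. The second condition pins the range (and so, by inversion, the
source) of \<open>D\<close> down in terms of \<open>h\<close>, which gives functoriality. Slices give star-bijectivity. Every
\<open>a\<close> with \<open>h \<in> \<theta> a\<close> lies in a coset related to \<open>h\<close>, obtained from a descending sequence below \<open>a\<close> by
multiplying with the elements of \<open>N\<close> at \<open>rng h\<close> (\<open>directed_germs_generate\<close>), and hence the relation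
induces \<open>\<theta>\<close>. A competing Zakrzewski morphism satisfies both conditions, and it coincides with the
classifying relation because cosets with the same range and a common element are equal.\<close>

section \<open>Groupoids\<close>

context
  fixes G :: "('g, 'm) groupoid_scheme"
  assumes G: "is_groupoid G"
begin

lemma ginv_arrow: "g \<in> arrows G \<Longrightarrow> ginv G g \<in> arrows G"
  and ginv_ginv: "g \<in> arrows G \<Longrightarrow> ginv G (ginv G g) = g"
  and gmult_arrow: "(g, h) \<in> composable G \<Longrightarrow> gmult G g h \<in> arrows G"
  and src_gmult: "(g, h) \<in> composable G \<Longrightarrow> src G (gmult G g h) = src G h"
  and rng_gmult: "(g, h) \<in> composable G \<Longrightarrow> rng G (gmult G g h) = rng G g"
  and gmult_assoc: "(g, h) \<in> composable G \<Longrightarrow> (h, k) \<in> composable G \<Longrightarrow>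
       gmult G (gmult G g h) k = gmult G g (gmult G h k)"
  and rng_gmult_left: "g \<in> arrows G \<Longrightarrow> gmult G (rng G g) g = g"
  and gmult_src_right: "g \<in> arrows G \<Longrightarrow> gmult G g (src G g) = g"
  using G unfolding is_groupoid_def by blast+

lemma src_ginv: "g \<in> arrows G \<Longrightarrow> src G (ginv G g) = rng G g"
  and rng_ginv: "g \<in> arrows G \<Longrightarrow> rng G (ginv G g) = src G g"
  by (simp_all add: src_def rng_def ginv_ginv)

lemma composable_ginv_left: "g \<in> arrows G \<Longrightarrow> (ginv G g, g) \<in> composable G"
  and composable_ginv_right: "g \<in> arrows G \<Longrightarrow> (g, ginv G g) \<in> composable G"
  by (simp_all add: composable_def ginv_arrow src_ginv rng_ginv)

lemma
  assumes g: "g \<in> arrows G"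
  shows src_arrow: "src G g \<in> arrows G"
    and src_src: "src G (src G g) = src G g"
    and rng_src: "rng G (src G g) = src G g"
    and rng_arrow: "rng G g \<in> arrows G"
    and src_rng: "src G (rng G g) = rng G g"
    and rng_rng: "rng G (rng G g) = rng G g"
proof -
  note l = composable_ginv_left[OF g] and r = composable_ginv_right[OF g]
  show "src G g \<in> arrows G" "src G (src G g) = src G g" "rng G (src G g) = src G g"
    using gmult_arrow[OF l] src_gmult[OF l] rng_gmult[OF l] rng_ginv[OF g] by (simp_all add: src_def)
  show "rng G g \<in> arrows G" "src G (rng G g) = rng G g" "rng G (rng G g) = rng G g"
    using gmult_arrow[OF r] src_gmult[OF r] rng_gmult[OF r] src_ginv[OF g] by (simp_all add: rng_def)
qed

lemma unitD:
  assumes "u \<in> units G" shows "u \<in> arrows G" "src G u = u" "rng G u = u"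
  using assms src_arrow src_src rng_src unfolding units_def by auto

lemma ginv_unique:
  assumes c: "(g, h) \<in> composable G" and e: "gmult G g h = rng G g"
  shows "h = ginv G g"
proof -
  have g: "g \<in> arrows G" and h: "h \<in> arrows G" and sr: "src G g = rng G h"
    using c unfolding composable_def by auto
  have "h = gmult G (gmult G (ginv G g) g) h"
    using rng_gmult_left[OF h] sr unfolding src_def by simp
  also have "\<dots> = gmult G (ginv G g) (rng G g)"
    using gmult_assoc[OF composable_ginv_left[OF g] c] e by simp
  also have "\<dots> = ginv G g" using gmult_src_right[OF ginv_arrow[OF g]] src_ginv[OF g] by simp
  finally show ?thesis .
qed

end

section \<open>Domination in a structured semigroup\<close>

locale structured =
  fixes N Z :: "'a::semigroup_mult set"
  assumes structured: "structured_semigroup N Z"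
begin

abbreviation dominated_via :: "'a \<Rightarrow> 'a \<Rightarrow> 'a \<Rightarrow> bool" ("_ \<lhd>\<^bsub>_\<^esub> _" [51, 0, 51] 50) where
  "a \<lhd>\<^bsub>s\<^esub> b \<equiv> domin_via N Z s a b"

abbreviation dominated :: "'a \<Rightarrow> 'a \<Rightarrow> bool" (infix "\<lhd>" 50) where
  "a \<lhd> b \<equiv> domin N Z a b"

abbreviation Up :: "'a set \<Rightarrow> 'a set" where "Up \<equiv> up N Z"
abbreviation Star :: "'a set \<Rightarrow> 'a set" where "Star \<equiv> star N Z"

lemma N_mult: "a \<in> N \<Longrightarrow> b \<in> N \<Longrightarrow> a * b \<in> N"
  using structured unfolding structured_semigroup_def subsemigroup_def by simp

lemma Z_mult: "a \<in> Z \<Longrightarrow> b \<in> Z \<Longrightarrow> a * b \<in> Z"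
  using structured unfolding structured_semigroup_def subsemigroup_def by simp

lemma Z_subset_center: "Z \<subseteq> center N"
  using structured unfolding structured_semigroup_def by simp

lemma Z_N: "z \<in> Z \<Longrightarrow> z \<in> N"
  using Z_subset_center unfolding center_def by blast

lemma Z_comm: "z \<in> Z \<Longrightarrow> n \<in> N \<Longrightarrow> z * n = n * z"
  using Z_subset_center unfolding center_def by auto

lemma Z_conj:
  assumes "a * b \<in> Z" "b * a \<in> Z" "z \<in> Z"
  shows "a * z * b \<in> Z"
proof -
  have "\<forall>a b. a * b \<in> Z \<and> b * a \<in> Z \<longrightarrow> (\<lambda>z. a * z * b) ` Z \<union> (\<lambda>z. b * z * a) ` Z \<subseteq> Z"
    using structured unfolding structured_semigroup_def by (elim conjE)
  then show ?thesis using assms by blast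
qed

text \<open>As \<open>ab\<close> is central in \<open>N\<close>, the equation \<open>abn = n\<close> already gives \<open>n = nab\<close>.\<close>

lemma N_conj:
  assumes "a * b \<in> Z" "b * a \<in> Z" "n \<in> N" "a * b * n = n"
  shows "b * n * a \<in> N"
proof -
  have "n * a * b = n" unfolding mult.assoc[of n a b] Z_comm[OF assms(1,3), symmetric]
    by (rule assms(4))
  then have "a * b * n = n \<and> n = n * a * b \<and> a * b \<in> Z \<and> b * a \<in> Z"
    using assms by (intro conjI) simp_all
  moreover have "\<forall>a b. \<forall>n \<in> N. a * b * n = n \<and> n = n * a * b \<and> a * b \<in> Z \<and> b * a \<in> Z \<longrightarrow>
      b * n * a \<in> N"
    using structured unfolding structured_semigroup_def by (elim conjE)
  ultimately show ?thesis using assms(3) by blast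
qed

text \<open>The last two equations are the first two in a form that rewrites inside right-nested
products.\<close>

lemma domv_eqs:
  assumes "a \<lhd>\<^bsub>s\<^esub> b"
  shows "a * (s * b) = a" "b * (s * a) = a" "a * (s * (b * x)) = a * x" "b * (s * (a * x)) = a * x"
proof -
  show 1: "a * (s * b) = a" and 2: "b * (s * a) = a"
    using assms unfolding domin_via_def mult.assoc by (blast, metis)
  have "a * (s * (b * x)) = a * (s * b) * x" by (simp add: mult.assoc)
  then show "a * (s * (b * x)) = a * x" by (simp only: 1)
  have "b * (s * (a * x)) = b * (s * a) * x" by (simp add: mult.assoc)
  then show "b * (s * (a * x)) = a * x" by (simp only: 2)
qed

lemma domvD:
  assumes "a \<lhd>\<^bsub>s\<^esub> b"
  shows "a * s \<in> N" "s * a \<in> N" "b * s \<in> Z" "s * b \<in> Z"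
  using assms unfolding domin_via_def by blast+

lemma domvI:
  assumes "a * (s * b) = a" "b * (s * a) = a" "a * s \<in> N" "s * a \<in> N" "b * s \<in> Z" "s * b \<in> Z"
  shows "a \<lhd>\<^bsub>s\<^esub> b"
  unfolding domin_via_def mult.assoc by (intro conjI assms assms(2)[symmetric])

lemma domI: "a \<lhd>\<^bsub>s\<^esub> b \<Longrightarrow> a \<lhd> b"
  unfolding domin_def by blast

lemma domE: assumes "a \<lhd> b" obtains s where "a \<lhd>\<^bsub>s\<^esub> b"
  using assms unfolding domin_def by blast

lemma domv_trans:
  assumes ab: "a \<lhd>\<^bsub>r\<^esub> b" and bc: "b \<lhd>\<^bsub>s\<^esub> c"
  shows "a \<lhd>\<^bsub>s\<^esub> c"
proof (rule domvI)
  note ab' = domv_eqs[OF ab] and bc' = domv_eqs[OF bc]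
  show "a * (s * c) = a" using ab'(3)[of "s * c"] unfolding bc'(1) ab'(1) by (rule sym)
  show "c * (s * a) = a" using bc'(4)[of "r * a"] unfolding ab'(2) .
  have "a * r * (b * s) \<in> N" by (rule N_mult[OF domvD(1)[OF ab] domvD(1)[OF bc]])
  then show "a * s \<in> N" by (simp only: mult.assoc ab')
  have "s * b * (r * a) \<in> N" by (rule N_mult[OF domvD(2)[OF bc] domvD(2)[OF ab]])
  then show "s * a \<in> N" by (simp only: mult.assoc ab')
qed (simp_all only: domvD[OF bc])

lemma dom_trans: "a \<lhd> b \<Longrightarrow> b \<lhd> c \<Longrightarrow> a \<lhd> c"
  unfolding domin_def using domv_trans by blast

lemma dom_via_trans: "a \<lhd> b \<Longrightarrow> b \<lhd>\<^bsub>s\<^esub> c \<Longrightarrow> a \<lhd>\<^bsub>s\<^esub> c"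
  unfolding domin_def using domv_trans by blast

text \<open>The inner factors \<open>ct\<close> and \<open>sb\<close> commute since \<open>sb\<close> is central in \<open>N\<close>. The products \<open>acts\<close> and
\<open>tsac\<close> are in \<open>N\<close> because both are conjugates of \<open>sact \<in> N\<close>.\<close>

lemma domv_mult:
  assumes ab: "a \<lhd>\<^bsub>s\<^esub> b" and cd: "c \<lhd>\<^bsub>t\<^esub> d"
  shows "a * c \<lhd>\<^bsub>t * s\<^esub> b * d"
proof (rule domvI)
  note e = domv_eqs[OF ab] domv_eqs[OF cd]
  note D = domvD[OF ab] domvD[OF cd]
  have k1: "c * t * (s * b) = s * b * (c * t)" by (rule Z_comm[OF D(4) D(5), symmetric])
  have k2: "d * t * (s * a) = s * a * (d * t)" by (rule Z_comm[OF D(7) D(2)])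
  have "a * c * (t * s * (b * d)) = a * (c * t * (s * b)) * d" by (simp add: mult.assoc)
  also have "\<dots> = a * c" by (simp only: k1) (simp add: mult.assoc e)
  finally show "a * c * (t * s * (b * d)) = a * c" .
  have "b * d * (t * s * (a * c)) = b * (d * t * (s * a)) * c" by (simp add: mult.assoc)
  also have "\<dots> = a * c" by (simp only: k2) (simp add: mult.assoc e)
  finally show "b * d * (t * s * (a * c)) = a * c" .
  have n: "s * a * (c * t) \<in> N" by (rule N_mult[OF D(2) D(5)])
  have "b * (s * a * (c * t)) * s \<in> N"
    by (rule N_conj[OF D(4) D(3) n]) (simp add: mult.assoc e)
  then show "a * c * (t * s) \<in> N" by (simp add: mult.assoc e)
  have "d * t * (s * a * (c * t)) = (d * t * (s * a)) * (c * t)" by (simp add: mult.assoc)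
  also have "\<dots> = s * a * (c * t)" by (simp only: k2) (simp add: mult.assoc e)
  finally have "t * (s * a * (c * t)) * d \<in> N" by (intro N_conj[OF D(7) D(8) n])
  then show "t * s * (a * c) \<in> N" by (simp add: mult.assoc e)
  show "b * d * (t * s) \<in> Z" using Z_conj[OF D(3) D(4) D(7)] by (simp add: mult.assoc)
  show "t * s * (b * d) \<in> Z" using Z_conj[OF D(8) D(7) D(4)] by (simp add: mult.assoc)
qed

lemma dom_mult: "a \<lhd> b \<Longrightarrow> c \<lhd> d \<Longrightarrow> a * c \<lhd> b * d"
  unfolding domin_def using domv_mult by blast

text \<open>Multiplication by an element of \<open>N\<close> can only shrink the support, so it keeps the element
below \<open>b\<close>, with the same witness.\<close>

lemma domv_mult_N_right:
  assumes ab: "a \<lhd>\<^bsub>s\<^esub> b" and n: "n \<in> N"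
  shows "a * n \<lhd>\<^bsub>s\<^esub> b"
proof (rule domvI)
  note e = domv_eqs[OF ab]
  note D = domvD[OF ab]
  have k: "n * (s * b) = s * b * n" by (rule Z_comm[OF D(4) n, symmetric])
  have "a * n * (s * b) = a * (n * (s * b))" by (simp add: mult.assoc)
  then show "a * n * (s * b) = a * n" by (simp only: k) (simp add: mult.assoc e)
  show "b * (s * (a * n)) = a * n" using e by simp
  show m: "s * (a * n) \<in> N" using N_mult[OF D(2) n] by (simp add: mult.assoc)
  have "b * (s * (a * n)) * s \<in> N" by (rule N_conj[OF D(4) D(3) m]) (simp add: mult.assoc e)
  then show "a * n * s \<in> N" by (simp add: mult.assoc e)
qed (simp_all only: domvD[OF ab])

lemma domv_mult_N_left:
  assumes ab: "a \<lhd>\<^bsub>s\<^esub> b" and n: "n \<in> N"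
  shows "n * a \<lhd>\<^bsub>s\<^esub> b"
proof (rule domvI)
  note e = domv_eqs[OF ab]
  note D = domvD[OF ab]
  have k: "b * s * n = n * (b * s)" by (rule Z_comm[OF D(3) n])
  have "b * (s * (n * a)) = b * s * n * a" by (simp add: mult.assoc)
  then show "b * (s * (n * a)) = n * a" by (simp only: k) (simp add: mult.assoc e)
  show "n * a * (s * b) = n * a" using e by (simp add: mult.assoc)
  show m: "n * a * s \<in> N" using N_mult[OF n D(1)] by (simp add: mult.assoc)
  have "b * s * (n * a * s) = b * s * n * a * s" by (simp add: mult.assoc)
  also have "\<dots> = n * a * s" by (simp only: k) (simp add: mult.assoc e)
  finally have "s * (n * a * s) * b \<in> N" by (rule N_conj[OF D(3) D(4) m])
  then show "s * (n * a) \<in> N" by (simp add: mult.assoc e)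
qed (simp_all only: domvD[OF ab])

lemma dom_mult_N_right: "a \<lhd> b \<Longrightarrow> n \<in> N \<Longrightarrow> a * n \<lhd> b"
  unfolding domin_def using domv_mult_N_right by blast

lemma dom_mult_N_left: "a \<lhd> b \<Longrightarrow> n \<in> N \<Longrightarrow> n * a \<lhd> b"
  unfolding domin_def using domv_mult_N_left by blast

text \<open>If \<open>n\<close> is supported where \<open>x\<close> inverts \<open>s\<close>, then cutting \<open>s\<close> down by \<open>n\<close> puts it below \<open>s\<close>.\<close>

lemma N_mult_domv:
  assumes "s * x \<in> Z" "x * s \<in> Z" "n \<in> N" "s * x * n = n"
  shows "n * s \<lhd>\<^bsub>x\<^esub> s"
proof (rule domvI)
  have k: "n * (s * x) = n" unfolding Z_comm[OF assms(1,3), symmetric] by (rule assms(4))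
  show "n * s * (x * s) = n * s" by (simp flip: mult.assoc) (simp add: mult.assoc k)
  show "s * (x * (n * s)) = n * s" using assms(4) by (simp flip: mult.assoc)
  show "n * s * x \<in> N" using k assms(3) by (simp add: mult.assoc)
  show "x * (n * s) \<in> N" using N_conj[OF assms] by (simp add: mult.assoc)
qed (use assms in auto)

lemma mult_N_domv:
  assumes "s * x \<in> Z" "x * s \<in> Z" "n \<in> N" "x * s * n = n"
  shows "s * n \<lhd>\<^bsub>x\<^esub> s"
proof (rule domvI)
  have k: "n * (x * s) = n" unfolding Z_comm[OF assms(2,3), symmetric] by (rule assms(4))
  show "s * n * (x * s) = s * n" by (simp flip: mult.assoc) (simp add: mult.assoc k)
  show "s * (x * (s * n)) = s * n" using assms(4) by (simp flip: mult.assoc)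
  show "s * n * x \<in> N" using N_conj[OF assms(2,1,3,4)] .
  show "x * (s * n) \<in> N" using assms(3,4) by (simp add: mult.assoc)
qed (use assms in auto)

text \<open>Between \<open>a\<close> and \<open>b\<close> the factor \<open>br\<close> acts as a cutoff function: the witness \<open>s\<close> may be
replaced by \<open>sbr\<close>, which is itself dominated. This is what makes \<open>Star\<close> of a rounded set rounded.\<close>

lemma domv_interpolate:
  assumes ab: "a \<lhd>\<^bsub>r\<^esub> b" and bc: "b \<lhd>\<^bsub>s\<^esub> c"
  shows "a \<lhd>\<^bsub>s * (b * r)\<^esub> c" "s * (b * r) \<lhd>\<^bsub>c\<^esub> s"
proof -
  note e = domv_eqs[OF ab] domv_eqs[OF bc]
  note D = domvD[OF ab] domvD[OF bc]
  have ac: "a \<lhd>\<^bsub>s\<^esub> c" by (rule domv_trans[OF ab bc])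
  note e = e domv_eqs[OF ac] and D' = domvD[OF ac]
  show "s * (b * r) \<lhd>\<^bsub>c\<^esub> s"
    by (rule mult_N_domv) (use D Z_N e in \<open>auto simp: mult.assoc\<close>)
  have k: "a * s * (b * r) = b * r * (a * s)" by (rule Z_comm[OF D(3) D'(1), symmetric])
  show "a \<lhd>\<^bsub>s * (b * r)\<^esub> c"
  proof (rule domvI)
    have "a * (s * (b * r) * c) = a * s * (b * r) * c" by (simp add: mult.assoc)
    then show "a * (s * (b * r) * c) = a" by (simp only: k) (simp add: mult.assoc e)
    show "c * (s * (b * r) * a) = a" by (simp add: mult.assoc e)
    have "a * s * (b * r) \<in> N" by (rule N_mult[OF D'(1) Z_N[OF D(3)]])
    then show "a * (s * (b * r)) \<in> N" by (simp add: mult.assoc)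
    show "s * (b * r) * a \<in> N" using D' by (simp add: mult.assoc e)
    show "c * (s * (b * r)) \<in> Z" using D by (simp add: mult.assoc e)
    show "s * (b * r) * c \<in> Z" using Z_conj[OF D(8,7,3)] by simp
  qed
qed

text \<open>Two elements inverse to \<open>d\<close> have the common lower bound \<open>sdt\<close>, because \<open>sd\<close> and \<open>dt\<close> are in
\<open>N\<close>.\<close>

lemma domv_common_lower:
  assumes ds: "d \<lhd>\<^bsub>s\<^esub> b" and dt: "d \<lhd>\<^bsub>t\<^esub> c"
  shows "s * d * t \<lhd>\<^bsub>b\<^esub> s" "s * d * t \<lhd>\<^bsub>c\<^esub> t"
proof -
  note e = domv_eqs[OF ds] domv_eqs[OF dt] and D = domvD[OF ds] domvD[OF dt]
  have "s * (d * t) \<lhd>\<^bsub>b\<^esub> s"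
    by (rule mult_N_domv) (use D e in \<open>auto simp: mult.assoc\<close>)
  then show "s * d * t \<lhd>\<^bsub>b\<^esub> s" by (simp add: mult.assoc)
  have "t * c * (s * d) = s * d * (t * c)" by (rule Z_comm) (use D in auto)
  then have "t * c * (s * d) = s * d" by (simp add: mult.assoc e)
  then show "s * d * t \<lhd>\<^bsub>c\<^esub> t"
    by (intro N_mult_domv) (use D in \<open>auto simp: mult.assoc\<close>)
qed

section \<open>Cosets\<close>

lemma UpI: "a \<in> A \<Longrightarrow> a \<lhd> b \<Longrightarrow> b \<in> Up A"
  unfolding up_def by blast

lemma UpE: assumes "b \<in> Up A" obtains a where "a \<in> A" "a \<lhd> b"
  using assms unfolding up_def by blast

lemma StarI: "a \<in> A \<Longrightarrow> a \<lhd>\<^bsub>s\<^esub> b \<Longrightarrow> s \<in> Star A"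
  unfolding star_def by blast

lemma StarE: assumes "s \<in> Star A" obtains a b where "a \<in> A" "a \<lhd>\<^bsub>s\<^esub> b"
  using assms unfolding star_def by blast

lemma Up_mono: "A \<subseteq> B \<Longrightarrow> Up A \<subseteq> Up B"
  unfolding up_def by blast

lemma Star_mono: "A \<subseteq> B \<Longrightarrow> Star A \<subseteq> Star B"
  unfolding star_def by blast

lemma Up_Up: "A \<subseteq> Up A \<Longrightarrow> Up (Up A) = Up A"
  unfolding up_def using dom_trans by blast

lemma rounded_mult:
  assumes "A \<subseteq> Up A" "B \<subseteq> Up B"
  shows "A * B \<subseteq> Up (A * B)"
proof
  fix x assume "x \<in> A * B"
  then obtain a b where x: "x = a * b" "a \<in> A" "b \<in> B" by (rule set_times_elim)
  obtain a' where a': "a' \<in> A" "a' \<lhd> a" using assms(1) x(2) by (blast elim: UpE)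
  obtain b' where b': "b' \<in> B" "b' \<lhd> b" using assms(2) x(3) by (blast elim: UpE)
  show "x \<in> Up (A * B)"
    unfolding x(1) by (rule UpI[OF set_times_intro[OF a'(1) b'(1)] dom_mult[OF a'(2) b'(2)]])
qed

lemma rounded_Up: "A \<subseteq> Up A \<Longrightarrow> Up A \<subseteq> Up (Up A)"
  using Up_Up by blast

lemma Up_mult_Up_subset:
  shows "Up A * Up B \<subseteq> Up (A * B)"
proof
  fix x assume "x \<in> Up A * Up B"
  then obtain a b where x: "x = a * b" "a \<in> Up A" "b \<in> Up B" by (rule set_times_elim)
  obtain a' where a': "a' \<in> A" "a' \<lhd> a" using x(2) by (rule UpE)
  obtain b' where b': "b' \<in> B" "b' \<lhd> b" using x(3) by (rule UpE)
  show "x \<in> Up (A * B)"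
    unfolding x(1) by (rule UpI[OF set_times_intro[OF a'(1) b'(1)] dom_mult[OF a'(2) b'(2)]])
qed

text \<open>Call \<open>A\<close> rounded if \<open>A \<subseteq> Up A\<close>. Together with the mirrored lemma below, this lets every
calculation with upward closures of rounded sets be done with plain, associative set products.\<close>

lemma Up_Up_mult:
  assumes "A \<subseteq> Up A" "B \<subseteq> Up B"
  shows "Up (Up A * B) = Up (A * B)"
proof
  have "Up A * B \<subseteq> Up (A * B)"
    using Up_mult_Up_subset[of A B] set_times_mono2[OF order.refl assms(2)] by blast
  then have "Up (Up A * B) \<subseteq> Up (Up (A * B))" by (rule Up_mono)
  then show "Up (Up A * B) \<subseteq> Up (A * B)" using Up_Up rounded_mult[OF assms] by blast
  show "Up (A * B) \<subseteq> Up (Up A * B)"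
    by (intro Up_mono set_times_mono2 assms order.refl)
qed

lemma Up_mult_Up:
  assumes "A \<subseteq> Up A" "B \<subseteq> Up B"
  shows "Up (A * Up B) = Up (A * B)"
proof
  have "A * Up B \<subseteq> Up (A * B)"
    using Up_mult_Up_subset[of A B] set_times_mono2[OF assms(1) order.refl] by blast
  then have "Up (A * Up B) \<subseteq> Up (Up (A * B))" by (rule Up_mono)
  then show "Up (A * Up B) \<subseteq> Up (A * B)" using Up_Up rounded_mult[OF assms] by blast
  show "Up (A * B) \<subseteq> Up (A * Up B)"
    by (intro Up_mono set_times_mono2 assms order.refl)
qed

abbreviation Coset :: "'a set \<Rightarrow> bool" where "Coset \<equiv> coset N Z"

lemma coset_Up: "Coset C \<Longrightarrow> Up C = C"
  unfolding coset_def by simp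

lemma coset_rounded: "Coset C \<Longrightarrow> C \<subseteq> Up C"
  using coset_Up by blast

lemma coset_triple: "Coset C \<Longrightarrow> C * Star C * C \<subseteq> C"
  unfolding coset_def by simp

lemma coset_mult: "Coset C \<Longrightarrow> a \<in> C \<Longrightarrow> s \<in> Star C \<Longrightarrow> b \<in> C \<Longrightarrow> a * s * b \<in> C"
  using coset_triple set_times_intro by blast

lemma coset_up: "Coset C \<Longrightarrow> a \<in> C \<Longrightarrow> a \<lhd> b \<Longrightarrow> b \<in> C"
  using coset_Up UpI by blast

lemma coset_below:
  assumes "Coset C" "c \<in> C" obtains b r where "b \<in> C" "b \<lhd>\<^bsub>r\<^esub> c"
  using assms coset_Up[OF assms(1)] by (blast elim: UpE domE)

lemma rounded_Star:
  assumes C: "C \<subseteq> Up C" and s: "s \<in> Star C"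
  obtains s' b where "s' \<in> Star C" "b \<in> Up C" "s' \<lhd>\<^bsub>b\<^esub> s"
proof -
  obtain a b where ab: "a \<in> C" "a \<lhd>\<^bsub>s\<^esub> b" using s by (rule StarE)
  obtain a' where a': "a' \<in> C" "a' \<lhd> a" using C ab(1) UpE by blast
  obtain r where r: "a' \<lhd>\<^bsub>r\<^esub> a" using a'(2) by (rule domE)
  note i = domv_interpolate[OF r ab(2)]
  show thesis
    by (rule that[OF StarI[OF a'(1) i(1)] UpI[OF ab(1) domI[OF ab(2)]] i(2)])
qed

lemma Star_subset_Up: "C \<subseteq> Up C \<Longrightarrow> Star C \<subseteq> Up (Star C)"
  by (blast elim: rounded_Star intro: UpI domI)

text \<open>Dominators of inverses are inverses of elements. The element produced is \<open>(pv)x(ra1)\<close>, a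
two-sided cutdown of \<open>x\<close> by elements of \<open>N\<close>. It lies in \<open>C\<close> because \<open>vxr\<close> is the witness of a
product domination whose lower element \<open>p\<close> is in \<open>C\<close>, so the coset condition applies to
\<open>p(vxr)a1\<close>.\<close>

lemma coset_Star_dominated:
  assumes C: "Coset C" and s: "s \<in> Star C" and st: "s \<lhd>\<^bsub>x\<^esub> t"
  obtains y where "y \<in> C" "y \<lhd>\<^bsub>t\<^esub> x"
proof -
  obtain a b where ab: "a \<in> C" "a \<lhd>\<^bsub>s\<^esub> b" using s by (rule StarE)
  have b: "b \<in> C" using coset_up[OF C ab(1) domI[OF ab(2)]] .
  obtain b0 v where b0: "b0 \<in> C" "b0 \<lhd>\<^bsub>v\<^esub> b" using C b by (rule coset_below)
  obtain a1 r where a1: "a1 \<in> C" "a1 \<lhd>\<^bsub>r\<^esub> a" using C ab(1) by (rule coset_below)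
  have a1b: "a1 \<lhd>\<^bsub>s\<^esub> b" using domv_trans[OF a1(2) ab(2)] .
  \<comment> \<open>The right factor \<open>b0\<close>, being dominated in \<open>C\<close>, puts \<open>p\<close> below \<open>b\<close> and makes \<open>pv\<close> an element of
  \<open>N\<close>.\<close>
  define p where "p = a1 * s * b0"
  have p: "p \<in> C" unfolding p_def using coset_mult[OF C a1(1) s b0(1)] .
  have pb: "p \<lhd>\<^bsub>v\<^esub> b" unfolding p_def
    using domv_mult_N_left[OF b0(2) domvD(1)[OF a1b]] .
  have big: "p \<lhd>\<^bsub>v * (x * r)\<^esub> a * (t * b)"
    using domv_mult[OF a1(2) domv_mult[OF st b0(2)]] unfolding p_def by (simp add: mult.assoc)
  have q: "v * (x * r) \<in> Star C" using StarI[OF p big] .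
  have "p * (v * (x * r)) * a1 \<in> C" using coset_mult[OF C p q a1(1)] .
  then have y: "p * v * x * (r * a1) \<in> C" by (simp add: mult.assoc)
  have "x * t * (a1 * s) = a1 * s * (x * t)" by (rule Z_comm) (fact domvD[OF st] domvD[OF a1b])+
  also have "\<dots> = a1 * s" by (simp add: mult.assoc domv_eqs[OF st])
  finally have "x * t * (a1 * s) * (b0 * v) = a1 * s * (b0 * v)" by simp
  then have xtp: "x * t * (p * v) = p * v" unfolding p_def by (simp add: mult.assoc)
  have "p * v * x \<lhd>\<^bsub>t\<^esub> x"
    by (rule N_mult_domv) (use domvD[OF st] domvD[OF pb] xtp in auto)
  then have "p * v * x * (r * a1) \<lhd>\<^bsub>t\<^esub> x"
    by (rule domv_mult_N_right) (rule domvD(2)[OF a1(2)])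
  then show thesis by (rule that[OF y])
qed

lemma coset_Star_up:
  assumes C: "Coset C" and s: "s \<in> Star C" and st: "s \<lhd>\<^bsub>x\<^esub> t"
  shows "t \<in> Star C"
proof -
  obtain y where "y \<in> C" "y \<lhd>\<^bsub>t\<^esub> x" using C s st by (rule coset_Star_dominated)
  then show ?thesis by (rule StarI)
qed

lemma Star_Star:
  assumes C: "Coset C"
  shows "Star (Star C) = C"
proof
  show "Star (Star C) \<subseteq> C"
  proof
    fix x assume "x \<in> Star (Star C)"
    then obtain s t where s: "s \<in> Star C" and st: "s \<lhd>\<^bsub>x\<^esub> t" by (rule StarE)
    obtain y where "y \<in> C" "y \<lhd>\<^bsub>t\<^esub> x" using C s st by (rule coset_Star_dominated)
    then show "x \<in> C" using coset_up[OF C _ domI] by blast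
  qed
  show "C \<subseteq> Star (Star C)"
  proof
    fix c assume c: "c \<in> C"
    obtain b s where b: "b \<in> C" "b \<lhd>\<^bsub>s\<^esub> c" using C c by (rule coset_below)
    obtain a r where a: "a \<in> C" "a \<lhd>\<^bsub>r\<^esub> b" using C b(1) by (rule coset_below)
    note i = domv_interpolate[OF a(2) b(2)]
    show "c \<in> Star (Star C)" by (rule StarI[OF StarI[OF a(1) i(1)] i(2)])
  qed
qed

lemma coset_Star:
  assumes C: "Coset C"
  shows "Coset (Star C)"
  unfolding coset_def
proof
  have "Up (Star C) \<subseteq> Star C"
    using coset_Star_up[OF C] by (blast elim: UpE domE)
  then show "Star C = Up (Star C)" using Star_subset_Up[OF coset_rounded[OF C]] by blast
  show "Star C * Star (Star C) * Star C \<subseteq> Star C"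
  proof
    fix x assume "x \<in> Star C * Star (Star C) * Star C"
    then obtain y t where yt: "x = y * t" "y \<in> Star C * C" "t \<in> Star C"
      unfolding Star_Star[OF C] by (rule set_times_elim)
    from yt(2) obtain s c where sc: "y = s * c" "s \<in> Star C" "c \<in> C" by (rule set_times_elim)
    obtain a b where a: "a \<in> C" "a \<lhd>\<^bsub>s\<^esub> b" using sc(2) by (rule StarE)
    obtain a' b' where a': "a' \<in> C" "a' \<lhd>\<^bsub>t\<^esub> b'" using yt(3) by (rule StarE)
    have "c \<in> Star (Star C)" using sc(3) Star_Star[OF C] by simp
    then obtain w v where w: "w \<in> Star C" "w \<lhd>\<^bsub>c\<^esub> v" by (rule StarE)
    have "a' * w * a \<lhd>\<^bsub>s * (c * t)\<^esub> b' * v * b"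
      by (rule domv_mult[OF domv_mult[OF a'(2) w(2)] a(2)])
    then have "s * (c * t) \<in> Star C" by (rule StarI[OF coset_mult[OF C a'(1) w(1) a(1)]])
    then show "x \<in> Star C" by (simp add: yt(1) sc(1) mult.assoc)
  qed
qed

text \<open>If \<open>a <\<^sub>s b\<close> then \<open>a = asb\<close>, so an element with an upper bound is itself a triple product.\<close>

lemma rounded_subset_triple:
  assumes C: "C \<subseteq> Up C"
  shows "C \<subseteq> Up (C * Star C * Up C)"
proof
  fix c assume "c \<in> C"
  then obtain b where b: "b \<in> C" "b \<lhd> c" using C by (blast elim: UpE)
  then obtain a where a: "a \<in> C" "a \<lhd> b" using C by (blast elim: UpE)
  obtain s where s: "a \<lhd>\<^bsub>s\<^esub> b" using a(2) by (rule domE)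
  have "a * s * b \<in> C * Star C * Up C"
    by (intro set_times_intro StarI[OF a(1) s] subsetD[OF C] a b)
  moreover have "a * s * b = a" by (simp add: mult.assoc domv_eqs[OF s])
  ultimately have "a \<in> C * Star C * Up C" by simp
  then show "c \<in> Up (C * Star C * Up C)" by (rule UpI[OF _ dom_trans[OF a(2) b(2)]])
qed

lemma coset_eq_triple:
  assumes C: "Coset C"
  shows "Up (C * Star C * C) = C"
proof
  show "Up (C * Star C * C) \<subseteq> C"
    using Up_mono[OF coset_triple[OF C]] coset_Up[OF C] by simp
  show "C \<subseteq> Up (C * Star C * C)"
    using rounded_subset_triple[OF coset_rounded[OF C]] coset_Up[OF C] by simp
qed

section \<open>Products of cosets\<close>

text \<open>Source and range in the coset groupoid, named separately so that they can be used before the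
groupoid structure is established.\<close>

definition coset_src :: "'a set \<Rightarrow> 'a set" where "coset_src C = Up (Star C * C)"
definition coset_rng :: "'a set \<Rightarrow> 'a set" where "coset_rng C = Up (C * Star C)"

lemma Star_rounded: "Coset C \<Longrightarrow> Star C \<subseteq> Up (Star C)"
  using Star_subset_Up coset_rounded by blast

lemma coset_src_Star: "Coset C \<Longrightarrow> coset_src (Star C) = coset_rng C"
  unfolding coset_src_def coset_rng_def by (simp add: Star_Star)

lemma coset_rng_Star: "Coset C \<Longrightarrow> coset_rng (Star C) = coset_src C"
  unfolding coset_src_def coset_rng_def by (simp add: Star_Star)

lemma mult_coset_src:
  assumes C: "Coset C"
  shows "Up (C * coset_src C) = C"
proof -
  have "Up (C * coset_src C) = Up (C * (Star C * C))" unfolding coset_src_def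
    by (rule Up_mult_Up[OF coset_rounded[OF C] rounded_mult[OF Star_rounded[OF C] coset_rounded[OF C]]])
  then show ?thesis using coset_eq_triple[OF C] by (simp add: mult.assoc)
qed

lemma coset_rng_mult:
  assumes C: "Coset C"
  shows "Up (coset_rng C * C) = C"
proof -
  have "Up (coset_rng C * C) = Up (C * Star C * C)" unfolding coset_rng_def
    by (rule Up_Up_mult[OF rounded_mult[OF coset_rounded[OF C] Star_rounded[OF C]] coset_rounded[OF C]])
  then show ?thesis using coset_eq_triple[OF C] by simp
qed

text \<open>This form of composability is the one that is used: multiplying by \<open>CC\<^sup>*\<close> on the right acts
on \<open>B\<close> like multiplying by \<open>B\<^sup>*B\<close>.\<close>

lemma mult_coset_rng_subset:
  assumes B: "Coset B" and C: "Coset C" and BC: "coset_src B = coset_rng C"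
  shows "B * (C * Star C) \<subseteq> B"
proof -
  have r: "C * Star C \<subseteq> Up (C * Star C)"
    by (rule rounded_mult[OF coset_rounded[OF C] Star_rounded[OF C]])
  have "B * (C * Star C) \<subseteq> B * coset_src B"
    unfolding BC coset_rng_def by (rule set_times_mono2[OF order.refl r])
  also have "\<dots> \<subseteq> Up (B * coset_src B)"
    by (rule rounded_mult[OF coset_rounded[OF B]], unfold coset_src_def,
        rule rounded_Up[OF rounded_mult[OF Star_rounded[OF B] coset_rounded[OF B]]])
  finally show ?thesis using mult_coset_src[OF B] by simp
qed

text \<open>Let \<open>bc <\<^sub>s x\<close>. For \<open>q \<in> C\<close> inverse to some \<open>r \<in> C\<^sup>*\<close>, the product \<open>qs\<close> is an inverse of \<open>bcw
\<in> B\<close>, whence \<open>qs \<in> B\<^sup>*\<close>. It would suffice that \<open>w(qs) \<in> C\<^sup>*B\<^sup>*\<close> be below \<open>s\<close>, but \<open>wq\<close> need not be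
supported where \<open>x\<close> inverts \<open>s\<close>. Inserting \<open>bcw \<in> B\<close> restricts the support: \<open>w(qs)(bcw)(qs)\<close> is
still in \<open>C\<^sup>*B\<^sup>*\<close>, and it equals \<open>ns\<close> with \<open>n = (wq)(sbc)(wq) \<in> N\<close> satisfying \<open>sxn = n\<close>.\<close>

lemma Star_mult_subset:
  assumes B: "Coset B" and C: "Coset C" and BC: "coset_src B = coset_rng C"
  shows "Star (Up (B * C)) \<subseteq> Up (Star C * Star B)"
proof
  fix s assume "s \<in> Star (Up (B * C))"
  then obtain e x where e: "e \<in> Up (B * C)" "e \<lhd>\<^bsub>s\<^esub> x" by (rule StarE)
  obtain d where d: "d \<in> B * C" "d \<lhd> e" using e(1) by (rule UpE)
  obtain b c where bc: "d = b * c" "b \<in> B" "c \<in> C" using d(1) by (rule set_times_elim)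
  have sx: "b * c \<lhd>\<^bsub>s\<^esub> x" using dom_via_trans[OF d(2) e(2)] bc(1) by simp
  obtain y r where "y \<in> C" and y: "y \<lhd>\<^bsub>r\<^esub> c" using C bc(3) by (rule coset_below)
  then have "r \<in> Star C" using StarI by blast
  then obtain w q where w: "w \<in> Star C" and q: "q \<in> Up C" and wq: "w \<lhd>\<^bsub>q\<^esub> r"
    by (rule rounded_Star[OF coset_rounded[OF C]])
  have q: "q \<in> C" using q coset_Up[OF C] by simp
  have bcw: "b * (c * w) \<in> B"
    using mult_coset_rng_subset[OF B C BC] bc(2,3) w set_times_intro by blast
  have "b * c * w \<lhd>\<^bsub>q * s\<^esub> x * r" by (rule domv_mult[OF sx wq])
  then have qs: "q * s \<in> Star B" using StarI bcw by (simp add: mult.assoc)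
  define n where "n = w * q * (s * (b * c)) * (w * q)"
  have "q * s * (b * (c * w)) * (q * s) \<in> Star B"
    using coset_mult[OF coset_Star[OF B] qs _ qs] bcw by (simp add: Star_Star[OF B])
  then have "w * (q * s * (b * (c * w)) * (q * s)) \<in> Star C * Star B"
    by (rule set_times_intro[OF w])
  then have ns: "n * s \<in> Star C * Star B" unfolding n_def by (simp add: mult.assoc)
  have nN: "n \<in> N" unfolding n_def
    by (intro N_mult[OF N_mult]) (fact domvD[OF wq] domvD[OF sx])+
  have k: "s * x * (w * q) = w * q * (s * x)"
    by (rule Z_comm) (fact domvD[OF wq] domvD[OF sx])+
  have k2: "s * x * (w * q) * (s * (b * c)) = w * q * (s * (b * c))"
    unfolding k by (simp add: mult.assoc domv_eqs(2)[OF sx])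
  have "s * x * n = s * x * (w * q) * (s * (b * c)) * (w * q)"
    unfolding n_def by (simp add: mult.assoc)
  then have "s * x * n = n" unfolding k2 n_def .
  then have "n * s \<lhd>\<^bsub>x\<^esub> s" by (rule N_mult_domv[OF domvD(4,3)[OF sx] nN])
  then show "s \<in> Up (Star C * Star B)" by (rule UpI[OF ns domI])
qed

lemma coset_product:
  assumes B: "Coset B" and C: "Coset C" and BC: "coset_src B = coset_rng C"
  shows "Coset (Up (B * C))"
  unfolding coset_def
proof
  note rB = coset_rounded[OF B] and rC = coset_rounded[OF C]
  note rB' = Star_rounded[OF B] and rC' = Star_rounded[OF C]
  note rBC = rounded_mult[OF rB rC] and rBC' = rounded_mult[OF rC' rB']
  show "Up (B * C) = Up (Up (B * C))" using Up_Up[OF rBC] by simp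
  let ?E = "Up (B * C)"
  have "?E * Star ?E * ?E \<subseteq> Up (B * C) * Up (Star C * Star B) * Up (B * C)"
    by (intro set_times_mono2 order.refl Star_mult_subset[OF B C BC])
  also have "\<dots> \<subseteq> Up (B * C * (Star C * Star B)) * Up (B * C)"
    by (intro set_times_mono2 order.refl Up_mult_Up_subset)
  also have "\<dots> \<subseteq> Up (B * C * (Star C * Star B) * (B * C))"
    by (rule Up_mult_Up_subset)
  also have "\<dots> = Up (B * (C * Star C) * Star B * B * C)" by (simp add: mult.assoc)
  also have "\<dots> \<subseteq> Up (B * Star B * B * C)"
    by (intro Up_mono set_times_mono2 order.refl mult_coset_rng_subset[OF B C BC])
  also have "\<dots> \<subseteq> Up (B * C)"
    by (intro Up_mono set_times_mono2 order.refl coset_triple[OF B])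
  finally show "?E * Star ?E * ?E \<subseteq> ?E" .
qed

lemma Star_mult:
  assumes B: "Coset B" and C: "Coset C" and BC: "coset_src B = coset_rng C"
  shows "Star (Up (B * C)) = Up (Star C * Star B)"
proof
  show "Star (Up (B * C)) \<subseteq> Up (Star C * Star B)" by (rule Star_mult_subset[OF assms])
  have CB: "coset_src (Star C) = coset_rng (Star B)" using BC
    by (simp add: coset_src_Star coset_rng_Star B C)
  note B' = coset_Star[OF B] and C' = coset_Star[OF C]
  have "Star (Up (Star C * Star B)) \<subseteq> Up (B * C)"
    using Star_mult_subset[OF C' B' CB] by (simp add: Star_Star B C)
  then have "Star (Star (Up (Star C * Star B))) \<subseteq> Star (Up (B * C))" by (rule Star_mono)
  then show "Up (Star C * Star B) \<subseteq> Star (Up (B * C))"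
    by (simp add: Star_Star coset_product[OF C' B' CB])
qed

lemma coset_src_mult:
  assumes B: "Coset B" and C: "Coset C" and BC: "coset_src B = coset_rng C"
  shows "coset_src (Up (B * C)) = coset_src C"
proof -
  note rB = coset_rounded[OF B] and rC = coset_rounded[OF C]
  note rB' = Star_rounded[OF B] and rC' = Star_rounded[OF C]
  note rm = rounded_mult
  have "coset_src (Up (B * C)) = Up (Up (Star C * Star B) * Up (B * C))"
    unfolding coset_src_def by (simp add: Star_mult[OF assms])
  also have "\<dots> = Up (Star C * Star B * Up (B * C))"
    by (rule Up_Up_mult[OF rm[OF rC' rB'] rounded_Up[OF rm[OF rB rC]]])
  also have "\<dots> = Up (Star C * Star B * (B * C))"
    by (rule Up_mult_Up[OF rm[OF rC' rB'] rm[OF rB rC]])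
  also have "\<dots> = Up (Star C * (Star B * B) * C)" by (simp add: mult.assoc)
  also have "\<dots> = Up (Up (Star C * (Star B * B)) * C)"
    by (rule Up_Up_mult[OF rm[OF rC' rm[OF rB' rB]] rC, symmetric])
  also have "Up (Star C * (Star B * B)) = Up (Star C * coset_src B)"
    unfolding coset_src_def by (rule Up_mult_Up[OF rC' rm[OF rB' rB], symmetric])
  also have "\<dots> = Star C"
    using mult_coset_src[OF coset_Star[OF C]] by (simp add: BC coset_src_Star C)
  finally show ?thesis unfolding coset_src_def .
qed

lemma coset_rng_mult_eq:
  assumes B: "Coset B" and C: "Coset C" and BC: "coset_src B = coset_rng C"
  shows "coset_rng (Up (B * C)) = coset_rng B"
proof -
  have CB: "coset_src (Star C) = coset_rng (Star B)" using BC
    by (simp add: coset_src_Star coset_rng_Star B C)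
  have "coset_rng (Up (B * C)) = coset_src (Star (Up (B * C)))"
    by (simp add: coset_src_Star coset_product[OF assms])
  also have "\<dots> = coset_src (Star B)"
    unfolding Star_mult[OF assms] by (rule coset_src_mult[OF coset_Star[OF C] coset_Star[OF B] CB])
  finally show ?thesis by (simp add: coset_src_Star B)
qed

lemma Up_mult_assoc:
  assumes "A \<subseteq> Up A" "B \<subseteq> Up B" "C \<subseteq> Up C"
  shows "Up (Up (A * B) * C) = Up (A * Up (B * C))"
  using Up_Up_mult[OF rounded_mult[OF assms(1,2)] assms(3)]
    Up_mult_Up[OF assms(1) rounded_mult[OF assms(2,3)]] by (simp add: mult.assoc)

section \<open>Directed cosets\<close>

abbreviation DC :: "'a set set" where "DC \<equiv> directed_cosets N Z"
abbreviation Directed :: "'a set \<Rightarrow> bool" where "Directed \<equiv> directed N Z"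

lemma directed_cosetI: "Coset D \<Longrightarrow> D \<noteq> {} \<Longrightarrow> Directed D \<Longrightarrow> D \<in> DC"
  unfolding directed_cosets_def cosets_def by simp

lemma directed_cosetD: assumes "D \<in> DC" shows "Coset D" "D \<noteq> {}" "Directed D"
  using assms unfolding directed_cosets_def cosets_def by simp_all

lemma directedE:
  assumes "Directed D" "a \<in> D" "b \<in> D" obtains d where "d \<in> D" "d \<lhd> a" "d \<lhd> b"
  using assms unfolding directed_def by blast

lemma directed_rounded: "Directed D \<Longrightarrow> D \<subseteq> Up D"
  unfolding directed_def up_def by blast

lemma directed_Up:
  assumes D: "Directed D" shows "Directed (Up D)"
  unfolding directed_def
proof (intro ballI)
  fix x y assume x: "x \<in> Up D" and y: "y \<in> Up D"
  obtain a where a: "a \<in> D" "a \<lhd> x" using x by (rule UpE)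
  obtain b where b: "b \<in> D" "b \<lhd> y" using y by (rule UpE)
  obtain d where d: "d \<in> D" "d \<lhd> a" "d \<lhd> b" using D a(1) b(1) by (rule directedE)
  have "d \<in> Up D" using d(1) directed_rounded[OF D] by blast
  then show "\<exists>d \<in> Up D. d \<lhd> x \<and> d \<lhd> y"
    using dom_trans[OF d(2) a(2)] dom_trans[OF d(3) b(2)] by blast
qed

lemma directed_mult:
  assumes A: "Directed A" and B: "Directed B" shows "Directed (A * B)"
  unfolding directed_def
proof (intro ballI)
  fix x y assume "x \<in> A * B" "y \<in> A * B"
  then obtain a b a' b' where xy: "x = a * b" "y = a' * b'" "a \<in> A" "b \<in> B" "a' \<in> A" "b' \<in> B"
    by (elim set_times_elim)
  obtain c where c: "c \<in> A" "c \<lhd> a" "c \<lhd> a'" using A xy(3,5) by (rule directedE)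
  obtain d where d: "d \<in> B" "d \<lhd> b" "d \<lhd> b'" using B xy(4,6) by (rule directedE)
  show "\<exists>d \<in> A * B. d \<lhd> x \<and> d \<lhd> y"
    unfolding xy using set_times_intro[OF c(1) d(1)] dom_mult c d by blast
qed

lemma directed_Star:
  assumes C: "Coset D" and D: "Directed D" shows "Directed (Star D)"
  unfolding directed_def
proof (intro ballI)
  fix s t assume s: "s \<in> Star D" and t: "t \<in> Star D"
  obtain a b where a: "a \<in> D" "a \<lhd>\<^bsub>s\<^esub> b" using s by (rule StarE)
  obtain a' b' where a': "a' \<in> D" "a' \<lhd>\<^bsub>t\<^esub> b'" using t by (rule StarE)
  obtain d where d: "d \<in> D" "d \<lhd> a" "d \<lhd> a'" using D a(1) a'(1) by (rule directedE)
  have "s * d * t \<in> Star D"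
    using coset_mult[OF coset_Star[OF C] s _ t] d(1) by (simp add: Star_Star[OF C])
  moreover note domv_common_lower[OF dom_via_trans[OF d(2) a(2)] dom_via_trans[OF d(3) a'(2)]]
  ultimately show "\<exists>d \<in> Star D. d \<lhd> s \<and> d \<lhd> t" using domI by blast
qed

lemma directed_coset_Star:
  assumes D: "D \<in> DC" shows "Star D \<in> DC"
proof (rule directed_cosetI)
  show "Coset (Star D)" by (rule coset_Star[OF directed_cosetD(1)[OF D]])
  show "Directed (Star D)" by (rule directed_Star[OF directed_cosetD(1,3)[OF D]])
  obtain c where c: "c \<in> D" using directed_cosetD(2)[OF D] by blast
  obtain b r where "b \<in> D" "b \<lhd>\<^bsub>r\<^esub> c" using directed_cosetD(1)[OF D] c by (rule coset_below)
  then show "Star D \<noteq> {}" using StarI by blast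
qed

lemma directed_coset_mult:
  assumes B: "B \<in> DC" and C: "C \<in> DC" and BC: "coset_src B = coset_rng C"
  shows "Up (B * C) \<in> DC"
proof (rule directed_cosetI)
  show "Coset (Up (B * C))"
    by (rule coset_product[OF directed_cosetD(1)[OF B] directed_cosetD(1)[OF C] BC])
  have d: "Directed (B * C)"
    by (rule directed_mult[OF directed_cosetD(3)[OF B] directed_cosetD(3)[OF C]])
  then show "Directed (Up (B * C))" by (rule directed_Up)
  obtain b c where "b \<in> B" "c \<in> C" using directed_cosetD(2) B C by blast
  then show "Up (B * C) \<noteq> {}" using directed_rounded[OF d] set_times_intro by blast
qed

lemma coset_src_directed: "D \<in> DC \<Longrightarrow> coset_src D \<in> DC"
  using directed_coset_mult[of "Star D" D] coset_src_Star[of D] directed_coset_Star[of D] directed_cosetD(1)[of D] unfolding coset_src_def[of D] by simp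

lemma coset_rng_directed: "D \<in> DC \<Longrightarrow> coset_rng D \<in> DC"
  using coset_src_directed[OF directed_coset_Star] coset_src_Star directed_cosetD(1) by metis

lemma coset_src_coset_src: "Coset D \<Longrightarrow> coset_src (coset_src D) = coset_src D"
  using coset_src_mult[of "Star D" D] coset_src_Star coset_Star unfolding coset_src_def[of D] by simp

lemma coset_src_coset_rng: "Coset D \<Longrightarrow> coset_src (coset_rng D) = coset_rng D"
  using coset_src_coset_src[of "Star D"] coset_src_Star coset_Star by simp

lemma Star_coset_src:
  assumes "Coset D" shows "Star (coset_src D) = coset_src D"
  using Star_mult[OF coset_Star[OF assms] assms coset_src_Star[OF assms]]
  by (simp add: coset_src_def Star_Star[OF assms])

lemma coset_rng_coset_src:
  assumes "Coset D" shows "coset_rng (coset_src D) = coset_src D"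
  using coset_rng_mult_eq[OF coset_Star[OF assms] assms coset_src_Star[OF assms]] coset_rng_Star[OF assms]
  by (simp add: coset_src_def)

lemma Star_mult_subset_coset_src: "Coset C \<Longrightarrow> Star C * C \<subseteq> coset_src C"
  unfolding coset_src_def by (rule rounded_mult[OF Star_rounded coset_rounded])

lemma mult_Star_subset_coset_rng: "Coset C \<Longrightarrow> C * Star C \<subseteq> coset_rng C"
  unfolding coset_rng_def by (rule rounded_mult[OF coset_rounded Star_rounded])

lemma mult_coset_src_subset:
  assumes C: "Coset C" shows "C * coset_src C \<subseteq> C"
proof -
  have "coset_src C \<subseteq> Up (coset_src C)"
    unfolding coset_src_def
      by (rule rounded_Up[OF rounded_mult[OF Star_rounded[OF C] coset_rounded[OF C]]])
  then have "C * coset_src C \<subseteq> Up (C * coset_src C)" by (rule rounded_mult[OF coset_rounded[OF C]])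
  then show ?thesis by (simp only: mult_coset_src[OF C])
qed

lemma coset_rng_mult_subset:
  assumes C: "Coset C" shows "coset_rng C * C \<subseteq> C"
proof -
  have "coset_rng C \<subseteq> Up (coset_rng C)"
    unfolding coset_rng_def
      by (rule rounded_Up[OF rounded_mult[OF coset_rounded[OF C] Star_rounded[OF C]]])
  then have "coset_rng C * C \<subseteq> Up (coset_rng C * C)" by (rule rounded_mult[OF _ coset_rounded[OF C]])
  then show ?thesis by (simp only: coset_rng_mult[OF C])
qed

text \<open>If \<open>d <\<^sub>s a\<close> with \<open>d\<close> below a given element of \<open>D\<close>, then \<open>d = a(sd)\<close> with \<open>sd\<close> in the common
source. So \<open>D\<close> is recovered from \<open>a\<close> and the source of \<open>D\<close>.\<close>

lemma subset_if_coset_src_eq: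
  assumes D: "Coset D" "Directed D" and E: "Coset E" and a: "a \<in> D" "a \<in> E" and eq: "coset_src D = coset_src E"
  shows "D \<subseteq> E"
proof
  fix x assume x: "x \<in> D"
  obtain d where d: "d \<in> D" "d \<lhd> x" "d \<lhd> a" using D(2) x a(1) by (rule directedE)
  obtain s where s: "d \<lhd>\<^bsub>s\<^esub> a" using d(3) by (rule domE)
  have "s * d \<in> coset_src E"
    using Star_mult_subset_coset_src[OF D(1)] set_times_intro[OF StarI[OF d(1) s] d(1)] eq by blast
  then have "a * (s * d) \<in> E" using mult_coset_src_subset[OF E] set_times_intro[OF a(2)] by blast
  then have "d \<in> E" by (simp add: domv_eqs[OF s])
  then show "x \<in> E" using coset_up[OF E _ d(2)] by blast
qed

lemma subset_if_coset_rng_eq: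
  assumes D: "Coset D" "Directed D" and E: "Coset E" and a: "a \<in> D" "a \<in> E" and eq: "coset_rng D = coset_rng E"
  shows "D \<subseteq> E"
proof
  fix x assume x: "x \<in> D"
  obtain d where d: "d \<in> D" "d \<lhd> x" "d \<lhd> a" using D(2) x a(1) by (rule directedE)
  obtain s where s: "d \<lhd>\<^bsub>s\<^esub> a" using d(3) by (rule domE)
  have "d * s \<in> coset_rng E"
    using mult_Star_subset_coset_rng[OF D(1)] set_times_intro[OF d(1) StarI[OF d(1) s]] eq by blast
  then have "d * s * a \<in> E" using coset_rng_mult_subset[OF E] set_times_intro[OF _ a(2)] by blast
  then have "d \<in> E" by (simp add: mult.assoc domv_eqs[OF s])
  then show "x \<in> E" using coset_up[OF E _ d(2)] by blast
qed

text \<open>Indeed \<open>a = (as)n\<close>.\<close>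

lemma dom_N: assumes "a \<lhd> n" "n \<in> N" shows "a \<in> N"
proof -
  obtain s where s: "a \<lhd>\<^bsub>s\<^esub> n" using assms(1) by (rule domE)
  have "a * s * n \<in> N" by (rule N_mult[OF domvD(1)[OF s] assms(2)])
  then show ?thesis by (simp add: mult.assoc domv_eqs[OF s])
qed

text \<open>In a group with a normal subsemigroup \<open>N\<close> and \<open>Z = {1}\<close> this says that a coset \<open>C\<close> meeting
\<open>N\<close> is a subgroup, and the argument is modelled on that case: \<open>cn\<^sup>-\<^sup>1\<close> is above \<open>c\<close>, hence in \<open>C\<close>,
and its inverse is \<open>nc\<^sup>-\<^sup>1\<close>. With \<open>c = n\<close>, in general \<open>r\<close> replaces \<open>n\<^sup>-\<^sup>1\<close> and \<open>q\<close> replaces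
\<open>c\<^sup>-\<^sup>1\<close>. The product \<open>nr\<close> dominates an element of \<open>C\<close> with witness \<open>n\<^sub>0q\<close>, so that \<open>n\<^sub>0q \<in> C\<^sup>*\<close> and
\<open>n\<^sub>0qc\<^sub>1 \<in> C\<^sup>*C\<close> lies below \<open>n\<close>.\<close>

lemma N_mem_coset_src:
  assumes C: "Coset C" and n: "n \<in> C" "n \<in> N"
  shows "n \<in> coset_src C"
proof -
  obtain n0 r' where n0: "n0 \<in> C" "n0 \<lhd>\<^bsub>r'\<^esub> n" using C n(1) by (rule coset_below)
  obtain n1 r where n1: "n1 \<in> C" "n1 \<lhd>\<^bsub>r\<^esub> n0" using C n0(1) by (rule coset_below)
  obtain c1 q where c1: "c1 \<in> C" "c1 \<lhd>\<^bsub>q\<^esub> n" using C n(1) by (rule coset_below)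
  have N0: "n0 \<in> N" and N1: "n1 \<in> N"
    using dom_N domI n0(2) n1(2) n(2) by blast+
  have "n0 * r * n1 = n1" using domv_eqs(2)[OF n1(2)] by (simp add: mult.assoc)
  then have "r * n1 \<lhd>\<^bsub>n0\<^esub> r" by (rule mult_N_domv[OF domvD(4,3)[OF n1(2)] N1])
  then have "c1 * (r * n1) \<lhd>\<^bsub>n0 * q\<^esub> n * r" by (rule domv_mult[OF c1(2)])
  moreover have "c1 * r * n1 \<in> C" by (rule coset_mult[OF C c1(1) StarI[OF n1] n1(1)])
  ultimately have "n0 * q \<in> Star C" using StarI by (simp add: mult.assoc)
  then have "n0 * q * c1 \<in> Star C * C" by (rule set_times_intro[OF _ c1(1)])
  moreover have "n0 * q * c1 \<lhd> n"
    using dom_mult_N_right[OF domI[OF n0(2)] domvD(2)[OF c1(2)]] by (simp add: mult.assoc)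
  ultimately show ?thesis unfolding coset_src_def by (rule UpI)
qed

lemma N_mem_unit:
  assumes D: "D \<in> DC" and n: "n \<in> D" "n \<in> N"
  shows "coset_src D = D"
proof
  note c = directed_cosetD(1)[OF D] and U = coset_src_directed[OF D]
  have m: "n \<in> coset_src D" by (rule N_mem_coset_src[OF c n])
  show "coset_src D \<subseteq> D"
    by (rule subset_if_coset_src_eq[OF directed_cosetD(1,3)[OF U] c m n(1) coset_src_coset_src[OF c]])
  show "D \<subseteq> coset_src D"
    by (rule subset_if_coset_src_eq[OF c directed_cosetD(3)[OF D] directed_cosetD(1)[OF U] n(1) m coset_src_coset_src[OF c, symmetric]])
qed

text \<open>For \<open>d <\<^sub>s b\<close> with \<open>s \<in> D\<^sup>*\<close> and \<open>d\<close> far enough down, \<open>sd \<in> N\<close> is below the given product.\<close>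

lemma coset_src_cofinal_N:
  assumes D: "Coset D" "Directed D" and u: "u \<in> coset_src D"
  obtains v where "v \<in> coset_src D" "v \<in> N" "v \<lhd> u"
proof -
  obtain x where x: "x \<in> Star D * D" "x \<lhd> u" using u unfolding coset_src_def by (rule UpE)
  obtain s c where sc: "x = s * c" "s \<in> Star D" "c \<in> D" using x(1) by (rule set_times_elim)
  obtain s0 y where s0: "s0 \<in> Star D" "s0 \<lhd>\<^bsub>y\<^esub> s"
    using coset_rounded[OF D(1)] sc(2) by (rule rounded_Star)
  obtain a b where a: "a \<in> D" "a \<lhd>\<^bsub>s0\<^esub> b" using s0(1) by (rule StarE)
  obtain d where d: "d \<in> D" "d \<lhd> a" "d \<lhd> c" using D(2) a(1) sc(3) by (rule directedE)
  show thesis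
  proof (rule that)
    show "s0 * d \<in> coset_src D" using Star_mult_subset_coset_src[OF D(1)] set_times_intro[OF s0(1) d(1)] by blast
    show "s0 * d \<in> N" by (rule domvD(2)[OF dom_via_trans[OF d(2) a(2)]])
    show "s0 * d \<lhd> u" using dom_trans[OF dom_mult[OF domI[OF s0(2)] d(3)]] x(2) sc(1) by simp
  qed
qed

text \<open>Translating a unit by an element that is invertible on it yields the coset through \<open>a\<close> with
prescribed range. Here \<open>pt \<in> U\<close> expresses that \<open>t\<close> inverts \<open>a\<close> over \<open>U\<close>. Inside \<open>U\<close> there is \<open>v \<in>
N\<close> with \<open>atv = v\<close>, and \<open>va\<close> and \<open>tv\<close> serve as smaller copies of \<open>a\<close> and its inverse \<open>t\<close>. The coset
condition reduces to \<open>as \<in> U\<close> for \<open>s \<in> B\<^sup>*\<close>, which holds since \<open>as\<close> is the witness of the product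
of a domination \<open>ua <\<^sub>s x\<close> with \<open>tv <\<^sub>a t\<close>, so that \<open>as \<in> U\<^sup>* = U\<close>.\<close>

lemma translate_unit:
  assumes U: "U \<in> DC" and unit: "coset_src U = U" and pa: "p \<lhd>\<^bsub>t\<^esub> a" and pt: "p * t \<in> U"
  defines "B \<equiv> Up (U * {a})"
  shows "B \<in> DC" "coset_rng B = U" "a \<in> B" "t \<in> Star B"
proof -
  note cU = directed_cosetD(1)[OF U] and dU = directed_cosetD(3)[OF U]
  have StU: "Star U = U" using Star_coset_src[OF cU] unit by simp
  have UU: "x * y \<in> U" if "x \<in> U" "y \<in> U" for x y
    using mult_coset_src_subset[OF cU] that unfolding unit by (blast intro: set_times_intro)
  obtain v where v: "v \<in> U" "v \<in> N" "v \<lhd> p * t"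
    using coset_src_cofinal_N[OF cU dU, of "p * t"] pt unfolding unit by blast
  obtain r where r: "v \<lhd>\<^bsub>r\<^esub> p * t" using v(3) by (rule domE)
  have "a * t * v = a * (t * (p * t * (r * v)))" by (simp only: domv_eqs(2)[OF r] mult.assoc[of a t v])
  also have "\<dots> = p * t * (r * v)" by (simp add: mult.assoc domv_eqs(4)[OF pa])
  finally have atv: "a * t * v = v" by (simp only: domv_eqs(2)[OF r])
  have va: "v * a \<lhd>\<^bsub>t\<^esub> a" by (rule N_mult_domv[OF domvD(3,4)[OF pa] v(2) atv])
  have tv: "t * v \<lhd>\<^bsub>a\<^esub> t" by (rule mult_N_domv[OF domvD(4,3)[OF pa] v(2) atv])
  have vat: "v * (a * t) = v" using Z_comm[OF domvD(3)[OF pa] v(2)] atv by simp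
  have memI: "u * a \<in> U * {a}" if "u \<in> U" for u using that by (blast intro: set_times_intro)
  have memE: "\<exists>u \<in> U. x = u * a" if "x \<in> U * {a}" for x using that by (blast elim: set_times_elim)
  have dir: "Directed (U * {a})"
    unfolding directed_def
  proof (intro ballI)
    fix x y assume "x \<in> U * {a}" "y \<in> U * {a}"
    then obtain u w where u: "u \<in> U" "w \<in> U" "x = u * a" "y = w * a" using memE by blast
    obtain d where d: "d \<in> U" "d \<lhd> u" "d \<lhd> w" using dU u(1,2) by (rule directedE)
    have "d * v * a \<in> U * {a}" by (rule memI[OF UU[OF d(1) v(1)]])
    moreover have "d * v * a \<lhd> x" "d * v * a \<lhd> y"
      unfolding u using dom_mult[OF d(2) domI[OF va]] dom_mult[OF d(3) domI[OF va]]
      by (simp_all add: mult.assoc)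
    ultimately show "\<exists>d \<in> U * {a}. d \<lhd> x \<and> d \<lhd> y" by blast
  qed
  note rA = directed_rounded[OF dir]
  have UpB: "Up B = B" unfolding B_def by (rule Up_Up[OF rA])
  have inB: "u * a \<in> B" if "u \<in> U" for u unfolding B_def using rA memI[OF that] by blast
  have BE: "\<exists>u \<in> U. u * a \<lhd> x" if "x \<in> B" for x
    using that memE unfolding B_def by (blast elim: UpE)
  show tB: "t \<in> Star B" by (rule StarI[OF inB[OF v(1)] va])
  show "a \<in> B" unfolding B_def by (rule UpI[OF memI[OF v(1)] domI[OF va]])
  then have ne: "B \<noteq> {}" by blast
  have aS: "a * s \<in> U" if s: "s \<in> Star B" for s
  proof -
    obtain e x where e: "e \<in> B" "e \<lhd>\<^bsub>s\<^esub> x" using s by (rule StarE)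
    obtain u where u: "u \<in> U" "u * a \<lhd> e" using BE[OF e(1)] by blast
    have "u * a * (t * v) \<lhd>\<^bsub>a * s\<^esub> x * t"
      by (rule domv_mult[OF dom_via_trans[OF u(2) e(2)] tv])
    moreover have "u * a * (t * v) = u * (a * t * v)" by (simp add: mult.assoc)
    ultimately have "u * v \<lhd>\<^bsub>a * s\<^esub> x * t" by (simp only: atv)
    then have "a * s \<in> Star U" by (rule StarI[OF UU[OF u(1) v(1)]])
    then show ?thesis by (simp add: StU)
  qed
  have rSB: "Star B \<subseteq> Up (Star B)" by (rule Star_subset_Up) (simp add: UpB)
  have cB: "Coset B"
    unfolding coset_def
  proof
    show "B = Up B" using UpB by simp
    show "B * Star B * B \<subseteq> B"
    proof
      fix x assume "x \<in> B * Star B * B"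
      then obtain c s d where x: "x = c * s * d" "c \<in> B" "s \<in> Star B" "d \<in> B"
        by (elim set_times_elim) blast
      obtain u1 where u1: "u1 \<in> U" "u1 * a \<lhd> c" using BE[OF x(2)] by blast
      obtain u2 where u2: "u2 \<in> U" "u2 * a \<lhd> d" using BE[OF x(4)] by blast
      obtain s0 where s0: "s0 \<in> Star B" "s0 \<lhd> s" using rSB x(3) by (blast elim: UpE)
      have "u1 * a * s0 * (u2 * a) \<lhd> x" unfolding x(1) by (intro dom_mult u1 s0 u2)
      moreover have "u1 * (a * s0) * u2 * a \<in> B" by (intro inB UU u1 u2 aS s0)
      ultimately show "x \<in> B" using UpI UpB by (metis mult.assoc)
    qed
  qed
  show "B \<in> DC" by (rule directed_cosetI[OF cB ne]) (unfold B_def, rule directed_Up[OF dir])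
  show "coset_rng B = U"
  proof
    show "coset_rng B \<subseteq> U"
    proof
      fix y assume "y \<in> coset_rng B"
      then obtain z where z: "z \<in> B * Star B" "z \<lhd> y" unfolding coset_rng_def by (rule UpE)
      obtain c s where cs: "z = c * s" "c \<in> B" "s \<in> Star B" using z(1) by (rule set_times_elim)
      obtain u where u: "u \<in> U" "u * a \<lhd> c" using BE[OF cs(2)] by blast
      obtain s0 where s0: "s0 \<in> Star B" "s0 \<lhd> s" using rSB cs(3) by (blast elim: UpE)
      have "u * a * s0 \<lhd> y" using dom_trans[OF dom_mult[OF u(2) s0(2)]] z(2) cs(1) by simp
      moreover have "u * (a * s0) \<in> U" by (rule UU[OF u(1) aS[OF s0(1)]])
      ultimately show "y \<in> U" using coset_up[OF cU] by (simp add: mult.assoc)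
    qed
    show "U \<subseteq> coset_rng B"
    proof
      fix u assume "u \<in> U"
      then obtain u1 where u1: "u1 \<in> U" "u1 \<lhd> u" using coset_rounded[OF cU] by (blast elim: UpE)
      have "u1 * v * a * t \<in> B * Star B" by (rule set_times_intro[OF inB[OF UU[OF u1(1) v(1)]] tB])
      then have "u1 * v \<in> B * Star B" by (simp add: mult.assoc vat)
      then show "u \<in> coset_rng B" unfolding coset_rng_def
        by (rule UpI[OF _ dom_mult_N_right[OF u1(2) v(2)]])
    qed
  qed
qed

section \<open>Factorisation under symmetry\<close>

lemma symmetricD: "symmetric Z \<Longrightarrow> a * b \<in> Z \<Longrightarrow> b * a * b * a \<in> Z"
  unfolding symmetric_def by blast

text \<open>The obvious inverse of \<open>a\<close> on \<open>dsa\<close> is \<open>bs\<close>, but only \<open>a(bs)\<close>, and not \<open>(bs)a\<close>, is known to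
be in \<open>Z\<close>. For \<open>t = (bs)a(bs)\<close> both \<open>at = (abs)\<^sup>2\<close> and, by symmetry, \<open>ta = (bsa)\<^sup>2\<close> are in \<open>Z\<close>.\<close>

lemma domv_factor_left:
  assumes sym: "symmetric Z" and d: "d \<lhd>\<^bsub>s\<^esub> a * b"
  shows "d * s * a \<lhd>\<^bsub>b * s * a * b * s\<^esub> a"
proof -
  note e = domv_eqs[OF d, unfolded mult.assoc] and D = domvD[OF d]
  have at: "a * (b * s * a * b * s) \<in> Z" using Z_mult[OF D(3) D(3)] by (simp add: mult.assoc)
  have ta: "b * s * a * b * s * a \<in> Z" using symmetricD[OF sym, of a "b * s"] D(3)
    by (simp add: mult.assoc)
  have "a * (b * s * a * b * s) * (d * s) = d * s" by (simp add: mult.assoc e(4))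
  then show ?thesis by (rule N_mult_domv[OF at ta D(1)])
qed

lemma domv_factor_right:
  assumes sym: "symmetric Z" and d: "d \<lhd>\<^bsub>s\<^esub> a * b"
  shows "b * (s * d) \<lhd>\<^bsub>s * a * b * s * a\<^esub> b"
proof -
  note e = domv_eqs[OF d, unfolded mult.assoc] and D = domvD[OF d]
  have tb: "s * a * b * s * a * b \<in> Z" using Z_mult[OF D(4) D(4)] by (simp add: mult.assoc)
  have bt: "b * (s * a * b * s * a) \<in> Z" using symmetricD[OF sym, of "s * a" b] D(4)
    by (simp add: mult.assoc)
  have "s * a * b * s * a * b * (s * d) = s * d" by (simp add: mult.assoc e(2))
  then show ?thesis by (rule mult_N_domv[OF bt tb D(2)])
qed

text \<open>With \<open>d <\<^sub>s ab\<close> in \<open>D\<close>, the left factor \<open>B\<close> is the translate of the range of \<open>D\<close> by \<open>a\<close>. The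
right factor is then forced to be \<open>B\<^sup>*D\<close>, and it contains \<open>b\<close> because \<open>td = bsd\<close> is below \<open>b\<close>.\<close>

lemma directed_coset_factor:
  assumes sym: "symmetric Z" and D: "D \<in> DC" and ab: "a * b \<in> D"
  obtains B C where "B \<in> DC" "C \<in> DC" "a \<in> B" "b \<in> C" "coset_src B = coset_rng C" "D = Up (B * C)"
proof -
  note cD = directed_cosetD(1)[OF D]
  obtain d s where d: "d \<in> D" "d \<lhd>\<^bsub>s\<^esub> a * b" using cD ab by (rule coset_below)
  define t where "t = b * s * a * b * s"
  note e = domv_eqs[OF d(2), unfolded mult.assoc]
  note pa = domv_factor_left[OF sym d(2), folded t_def]
  have "d * s * a * t = d * s" unfolding t_def by (simp add: mult.assoc e(3))
  moreover have "d * s \<in> coset_rng D"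
    using mult_Star_subset_coset_rng[OF cD] set_times_intro[OF d(1) StarI[OF d]] by blast
  ultimately have pt: "d * s * a * t \<in> coset_rng D" by simp
  define B where "B = Up (coset_rng D * {a})"
  note B = translate_unit[OF coset_rng_directed[OF D] coset_src_coset_rng[OF cD] pa pt, folded B_def]
  note cB = directed_cosetD(1)[OF B(1)]
  define C where "C = Up (Star B * D)"
  have comp: "coset_src (Star B) = coset_rng D" by (simp add: coset_src_Star cB B(2))
  have C: "C \<in> DC" unfolding C_def by (rule directed_coset_mult[OF directed_coset_Star[OF B(1)] D comp])
  have "coset_rng C = coset_src B"
    unfolding C_def by (simp add: coset_rng_mult_eq[OF coset_Star[OF cB] cD comp] coset_rng_Star[OF cB])
  moreover have "Up (B * C) = Up (coset_rng B * D)" unfolding C_def coset_rng_def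
    by (rule Up_mult_assoc[symmetric]) (intro coset_rounded Star_rounded cB cD)+
  then have "D = Up (B * C)" by (simp add: B(2) coset_rng_mult[OF cD])
  moreover have "t * d = b * (s * d)" unfolding t_def by (simp add: mult.assoc e(2))
  then have "t * d \<lhd> b" using domI[OF domv_factor_right[OF sym d(2)]] by simp
  then have "b \<in> C" unfolding C_def by (rule UpI[OF set_times_intro[OF B(4) d(1)]])
  ultimately show thesis using that[OF B(1) C B(3)] by simp
qed

section \<open>The etale groupoid of directed cosets\<close>

abbreviation DG :: "'a set top_groupoid" where "DG \<equiv> directed_coset_groupoid N Z"
abbreviation rep :: "'a \<Rightarrow> 'a set set" where "rep \<equiv> directed_coset_rep N Z"

lemma DG_simps [simp]:
  "arrows DG = DC" "gmult DG B C = Up (B * C)" "ginv DG B = Star B"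
  by (simp_all add: directed_coset_groupoid_def coset_groupoid_def)

lemma gtop_DG: "gtop DG =
    subtopology (topology_generated_by (range (\<lambda>a. {C \<in> cosets N Z. a \<in> C}))) DC"
  by (simp add: directed_coset_groupoid_def coset_groupoid_def)

lemma src_DG: "src DG D = coset_src D" and rng_DG: "rng DG D = coset_rng D"
  by (simp_all add: src_def rng_def coset_src_def coset_rng_def)

lemma composable_DG: "(B, C) \<in> composable DG \<longleftrightarrow> B \<in> DC \<and> C \<in> DC \<and> coset_src B = coset_rng C"
  by (simp add: composable_def src_DG rng_DG)

lemma groupoid_DG: "is_groupoid DG"
  unfolding is_groupoid_def composable_DG DG_simps src_DG rng_DG
proof (intro conjI ballI allI impI; (elim conjE)?)
  fix B assume "B \<in> DC"
  then show "Star B \<in> DC" "Star (Star B) = B" "Up (coset_rng B * B) = B" "Up (B * coset_src B) = B"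
    using directed_coset_Star Star_Star coset_rng_mult mult_coset_src directed_cosetD(1) by simp_all
next
  fix B C assume "B \<in> DC" "C \<in> DC" "coset_src B = coset_rng C"
  then show "Up (B * C) \<in> DC" "coset_src (Up (B * C)) = coset_src C" "coset_rng (Up (B * C)) = coset_rng B"
    using directed_coset_mult coset_src_mult coset_rng_mult_eq directed_cosetD(1) by simp_all
next
  fix A B C assume "A \<in> DC" "B \<in> DC" "C \<in> DC"
  then show "Up (Up (A * B) * C) = Up (A * Up (B * C))"
    by (intro Up_mult_assoc coset_rounded directed_cosetD(1))
qed

lemma mem_rep: "D \<in> rep a \<longleftrightarrow> D \<in> DC \<and> a \<in> D"
  by (simp add: directed_coset_rep_def)

lemma rep_mono: "a \<lhd> b \<Longrightarrow> rep a \<subseteq> rep b"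
  using coset_up directed_cosetD(1) by (auto simp: mem_rep)

text \<open>The subbasic sets \<open>rep a\<close> form a basis, because directed cosets are directed.\<close>

lemma openin_DG: "openin (gtop DG) U \<longleftrightarrow> U \<subseteq> DC \<and> (\<forall>D \<in> U. \<exists>a \<in> D. rep a \<subseteq> U)"
proof
  assume "openin (gtop DG) U"
  then obtain T where gen: "generate_topology_on (range (\<lambda>a. {C \<in> cosets N Z. a \<in> C})) T"
    and U: "U = T \<inter> DC"
    unfolding gtop_DG openin_subtopology openin_topology_generated_by_iff by blast
  have "\<forall>D \<in> T \<inter> DC. \<exists>a \<in> D. rep a \<subseteq> T" using gen
  proof induction
    case Empty
    then show ?case by simp
  next
    case (Int A B)
    show ?case
    proof
      fix D assume D: "D \<in> A \<inter> B \<inter> DC"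
      then obtain a b where ab: "a \<in> D" "b \<in> D" "rep a \<subseteq> A" "rep b \<subseteq> B" using Int by blast
      obtain d where "d \<in> D" "d \<lhd> a" "d \<lhd> b" using directed_cosetD(3) D ab(1,2)
        by (blast elim: directedE)
      then show "\<exists>a \<in> D. rep a \<subseteq> A \<inter> B" using ab rep_mono by blast
    qed
  next
    case (UN K)
    show ?case
    proof
      fix D assume "D \<in> \<Union> K \<inter> DC"
      then obtain k where k: "k \<in> K" "D \<in> k \<inter> DC" by blast
      obtain a where "a \<in> D" "rep a \<subseteq> k" using UN[OF k(1)] k(2) by blast
      then show "\<exists>a \<in> D. rep a \<subseteq> \<Union> K" using k(1) by blast
    qed
  next
    case (Basis s)
    then show ?case by (auto simp: mem_rep directed_cosets_def)
  qed
  moreover have "rep a \<subseteq> DC" for a by (auto simp: mem_rep)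
  ultimately show "U \<subseteq> DC \<and> (\<forall>D \<in> U. \<exists>a \<in> D. rep a \<subseteq> U)"
    unfolding U by (simp add: le_inf_iff)
next
  assume U: "U \<subseteq> DC \<and> (\<forall>D \<in> U. \<exists>a \<in> D. rep a \<subseteq> U)"
  have basic: "openin (gtop DG) (rep a)" for a
  proof -
    have "rep a = {C \<in> cosets N Z. a \<in> C} \<inter> DC"
      by (auto simp: mem_rep directed_cosets_def)
    moreover have "openin (topology_generated_by (range (\<lambda>a. {C \<in> cosets N Z. a \<in> C})))
        {C \<in> cosets N Z. a \<in> C}"
      by (rule topology_generated_by_Basis[OF rangeI])
    ultimately show ?thesis unfolding gtop_DG by (simp only: openin_subtopology_Int)
  qed
  show "openin (gtop DG) U"
  proof (subst openin_subopen, intro ballI)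
    fix D assume "D \<in> U"
    then obtain a where a: "a \<in> D" "rep a \<subseteq> U" and "D \<in> DC" using U by blast
    then have "D \<in> rep a" by (simp add: mem_rep)
    then show "\<exists>T. openin (gtop DG) T \<and> D \<in> T \<and> T \<subseteq> U" using basic[of a] a(2) by blast
  qed
qed

lemma openin_rep: "openin (gtop DG) (rep a)"
  by (auto simp: openin_DG mem_rep)

lemma topspace_DG: "topspace (gtop DG) = DC"
proof
  show "topspace (gtop DG) \<subseteq> DC" using openin_DG[of "topspace (gtop DG)"] by simp
  have "openin (gtop DG) DC" using directed_cosetD(2) by (fastforce simp: openin_DG mem_rep)
  then show "DC \<subseteq> topspace (gtop DG)" by (rule openin_subset)
qed

lemma continuous_Star: "continuous_map (gtop DG) (gtop DG) Star"
  unfolding continuous_map_def topspace_DG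
proof (intro conjI allI impI)
  show "Star \<in> DC \<rightarrow> DC" using directed_coset_Star by blast
  fix U assume U: "openin (gtop DG) U"
  show "openin (gtop DG) {D \<in> DC. Star D \<in> U}"
    unfolding openin_DG
  proof (intro conjI ballI)
    fix D assume D: "D \<in> {D \<in> DC. Star D \<in> U}"
    then obtain s where s: "s \<in> Star D" "rep s \<subseteq> U" using U by (auto simp: openin_DG)
    obtain a b where ab: "a \<in> D" "a \<lhd>\<^bsub>s\<^esub> b" using s(1) by (rule StarE)
    have "rep a \<subseteq> {D \<in> DC. Star D \<in> U}"
      using s(2) StarI[OF _ ab(2)] directed_coset_Star by (fastforce simp: mem_rep)
    then show "\<exists>a \<in> D. rep a \<subseteq> {D \<in> DC. Star D \<in> U}" using ab(1) by blast
  qed blast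
qed

lemma continuous_mult:
  "continuous_map (subtopology (prod_topology (gtop DG) (gtop DG)) (composable DG)) (gtop DG)
    (\<lambda>(B, C). Up (B * C))"
proof -
  let ?X = "subtopology (prod_topology (gtop DG) (gtop DG)) (composable DG)"
  have top: "topspace ?X = composable DG"
    by (auto simp: topspace_DG composable_DG)
  show ?thesis
    unfolding continuous_map_def top topspace_DG
  proof (intro conjI allI impI)
    show "(\<lambda>(B, C). Up (B * C)) \<in> composable DG \<rightarrow> DC" using directed_coset_mult
      by (auto simp: composable_DG)
    fix U assume U: "openin (gtop DG) U"
    show "openin ?X {x \<in> composable DG. (case x of (B, C) \<Rightarrow> Up (B * C)) \<in> U}" (is "openin _ ?V")
    proof (subst openin_subopen, intro ballI)
      fix x assume x: "x \<in> ?V"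
      obtain B C where BC: "x = (B, C)" by (cases x)
      then obtain a where a: "a \<in> Up (B * C)" "rep a \<subseteq> U" using U x by (auto simp: openin_DG)
      obtain y where y: "y \<in> B * C" "y \<lhd> a" using a(1) by (rule UpE)
      obtain b c where bc: "y = b * c" "b \<in> B" "c \<in> C" using y(1) by (rule set_times_elim)
      let ?W = "(rep b \<times> rep c) \<inter> composable DG"
      have "openin (prod_topology (gtop DG) (gtop DG)) (rep b \<times> rep c)"
        by (simp add: openin_prod_Times_iff openin_rep)
      then have "openin ?X ?W" by (rule openin_subtopology_Int)
      moreover have "x \<in> ?W" using x BC bc by (auto simp: mem_rep composable_DG)
      moreover have "?W \<subseteq> ?V"
      proof
        fix w assume w: "w \<in> ?W"
        then obtain B' C' where w': "w = (B', C')" "b \<in> B'" "c \<in> C'" "(B', C') \<in> composable DG"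
          by (auto simp: mem_rep)
        have "a \<in> Up (B' * C')" using UpI[OF set_times_intro[OF w'(2,3)]] y(2) bc(1) by simp
        then have "Up (B' * C') \<in> rep a" using directed_coset_mult w'(4)
          by (simp add: mem_rep composable_DG)
        then show "w \<in> ?V" using a(2) w' by auto
      qed
      ultimately show "\<exists>T. openin ?X T \<and> x \<in> T \<and> T \<subseteq> ?V" by blast
    qed
  qed
qed

lemma rep_mult:
  assumes sym: "symmetric Z"
  shows "rep (a * b) = slice_mult DG (rep a) (rep b)"
proof
  show "rep (a * b) \<subseteq> slice_mult DG (rep a) (rep b)"
  proof
    fix D assume "D \<in> rep (a * b)"
    then have "D \<in> DC" "a * b \<in> D" by (simp_all add: mem_rep)
    then obtain B C where "B \<in> DC" "C \<in> DC" "a \<in> B" "b \<in> C" "coset_src B = coset_rng C" "D = Up (B * C)"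
      by (rule directed_coset_factor[OF sym])
    then show "D \<in> slice_mult DG (rep a) (rep b)"
      unfolding slice_mult_def by (auto simp: mem_rep composable_DG)
  qed
  show "slice_mult DG (rep a) (rep b) \<subseteq> rep (a * b)"
  proof
    fix D assume "D \<in> slice_mult DG (rep a) (rep b)"
    then obtain B C where BC: "D = Up (B * C)" "B \<in> DC" "C \<in> DC" "a \<in> B" "b \<in> C" "coset_src B = coset_rng C"
      unfolding slice_mult_def by (auto simp: mem_rep composable_DG)
    have "B * C \<subseteq> Up (B * C)" by (intro rounded_mult coset_rounded directed_cosetD(1) BC)
    then show "D \<in> rep (a * b)" using BC directed_coset_mult set_times_intro by (auto simp: mem_rep)
  qed
qed

lemma rep_N_units:
  assumes "n \<in> N" shows "rep n \<subseteq> units DG"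
proof
  fix D assume D: "D \<in> rep n"
  then have "coset_src D = D" using N_mem_unit[of D n] assms by (simp add: mem_rep)
  then show "D \<in> units DG" using D by (auto simp: units_def src_DG mem_rep intro: rev_image_eqI)
qed

text \<open>Openness of the source map: if \<open>d <\<^sub>s a\<close> in \<open>D\<close>, then \<open>rep (s * d)\<close> is a neighbourhood of the
source of \<open>D\<close>. It consists of units because \<open>sd \<in> N\<close>, and such a unit factors as a product whose
right factor contains \<open>d\<close>, hence \<open>a\<close>. The source of that factor is the given unit.\<close>

lemma etale_DG:
  assumes sym: "symmetric Z"
  shows "etale_groupoid DG"
  unfolding etale_groupoid_def topological_groupoid_def DG_simps(1,2)
proof (intro conjI allI impI)
  show "is_groupoid DG" by (rule groupoid_DG)
  show "topspace (gtop DG) = DC" by (rule topspace_DG)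
  have "ginv DG = Star" by (rule ext) simp
  then show "continuous_map (gtop DG) (gtop DG) (ginv DG)" using continuous_Star by simp
  have "gmult DG = (\<lambda>B C. Up (B * C))" by (intro ext) simp
  then show "continuous_map (subtopology (prod_topology (gtop DG) (gtop DG)) (composable DG)) (gtop DG)
      (\<lambda>(B, C). Up (B * C))"
    using continuous_mult by simp
  fix U assume U: "openin (gtop DG) U"
  show "openin (gtop DG) (src DG ` U)"
    unfolding openin_DG
  proof (intro conjI ballI)
    show "src DG ` U \<subseteq> DC" using U coset_src_directed by (auto simp: openin_DG src_DG)
    fix E assume "E \<in> src DG ` U"
    then obtain D where D: "D \<in> U" "E = coset_src D" by (auto simp: src_DG)
    then have DD: "D \<in> DC" using U by (auto simp: openin_DG)
    obtain a where a: "a \<in> D" "rep a \<subseteq> U" using U D(1) by (auto simp: openin_DG)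
    obtain d s where d: "d \<in> D" "d \<lhd>\<^bsub>s\<^esub> a" using directed_cosetD(1)[OF DD] a(1) by (rule coset_below)
    have "s * d \<in> E"
      using Star_mult_subset_coset_src[OF directed_cosetD(1)[OF DD]] set_times_intro[OF StarI[OF d] d(1)] D(2) by blast
    moreover have "rep (s * d) \<subseteq> src DG ` U"
    proof
      fix F assume F: "F \<in> rep (s * d)"
      then have unit: "coset_src F = F" using N_mem_unit[of F, OF _ _ domvD(2)[OF d(2)]]
        by (simp add: mem_rep)
      from F have "F \<in> DC" "s * d \<in> F" by (simp_all add: mem_rep)
      then obtain B C where BC: "B \<in> DC" "C \<in> DC" "s \<in> B" "d \<in> C" "coset_src B = coset_rng C" "F = Up (B * C)"
        by (rule directed_coset_factor[OF sym])
      then have "F = coset_src C" using coset_src_mult[of B C] unit directed_cosetD(1) by simp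
      moreover have "C \<in> U" using BC(2,4) rep_mono[OF domI[OF d(2)]] a(2) by (auto simp: mem_rep)
      ultimately show "F \<in> src DG ` U" by (auto simp: src_DG)
    qed
    ultimately show "\<exists>a \<in> E. rep a \<subseteq> src DG ` U" by blast
  qed
qed

lemma slice_rep: "slice DG (rep a)"
proof -
  have "D = E" if "D \<in> DC" "E \<in> DC" "a \<in> D" "a \<in> E" "coset_src D = coset_src E" for D E
    using subset_if_coset_src_eq[of D E a] subset_if_coset_src_eq[of E D a] directed_cosetD that by simp
  moreover have "D = E" if "D \<in> DC" "E \<in> DC" "a \<in> D" "a \<in> E" "coset_rng D = coset_rng E" for D E
    using subset_if_coset_rng_eq[of D E a] subset_if_coset_rng_eq[of E D a] directed_cosetD that by simp
  ultimately show ?thesis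
    unfolding slice_def inj_on_def src_DG rng_DG by (auto simp: mem_rep)
qed

theorem etale_representation_rep:
  assumes sym: "symmetric Z"
  shows "etale_representation N Z DG rep"
  unfolding etale_representation_def
proof (intro conjI allI ballI impI)
  show "etale_groupoid DG" by (rule etale_DG[OF sym])
  show "range rep \<subseteq> open_slices DG" using openin_rep slice_rep by (auto simp: open_slices_def)
  show "rep (a * b) = slice_mult DG (rep a) (rep b)" for a b by (rule rep_mult[OF sym])
  show "(\<Union>a. rep a) = arrows DG" using directed_cosetD(2) by (fastforce simp: mem_rep)
  show "openin (subtopology (gtop DG) (units DG)) (rep n)" if "n \<in> N" for n
    using openin_rep[of n] rep_N_units[OF that] by (auto simp: openin_subtopology)
  fix D a assume "D \<in> arrows DG" "D \<in> rep a"
  then have D: "D \<in> DC" "a \<in> D" by (simp_all add: mem_rep)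
  obtain b s where "b \<in> D" "b \<lhd>\<^bsub>s\<^esub> a" using directed_cosetD(1)[OF D(1)] D(2) by (rule coset_below)
  then show "\<exists>b. b \<lhd> a \<and> D \<in> rep b" using D(1) domI by (auto simp: mem_rep)
qed

end

section \<open>Germs of an etale representation\<close>

locale etale_rep = structured N Z for N Z :: "'a::semigroup_mult set" +
  fixes H :: "'h top_groupoid" and \<theta> :: "'a \<Rightarrow> 'h set"
  assumes rep_H: "etale_representation N Z H \<theta>"
begin

lemma H: "is_groupoid H"
  using rep_H unfolding etale_representation_def etale_groupoid_def topological_groupoid_def by simp

lemma theta_open: "openin (gtop H) (\<theta> a)" and theta_slice: "slice H (\<theta> a)"
proof -
  have "range \<theta> \<subseteq> open_slices H" using rep_H unfolding etale_representation_def by (elim conjE)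
  then have "\<theta> a \<in> open_slices H" by blast
  then show "openin (gtop H) (\<theta> a)" "slice H (\<theta> a)" by (simp_all add: open_slices_def)
qed

lemma theta_arrow: "h \<in> \<theta> a \<Longrightarrow> h \<in> arrows H"
  using theta_slice unfolding slice_def by blast

lemma theta_rng_inj: "g \<in> \<theta> a \<Longrightarrow> h \<in> \<theta> a \<Longrightarrow> rng H g = rng H h \<Longrightarrow> g = h"
  using theta_slice[of a] unfolding slice_def inj_on_def by blast

lemma theta_mult: "\<theta> (a * b) = slice_mult H (\<theta> a) (\<theta> b)"
  using rep_H unfolding etale_representation_def by simp

lemma theta_multI:
  "g \<in> \<theta> a \<Longrightarrow> h \<in> \<theta> b \<Longrightarrow> src H g = rng H h \<Longrightarrow> gmult H g h \<in> \<theta> (a * b)"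
  unfolding theta_mult slice_mult_def composable_def using theta_arrow by blast

lemma theta_multE:
  assumes "k \<in> \<theta> (a * b)"
  obtains g h where "k = gmult H g h" "g \<in> \<theta> a" "h \<in> \<theta> b" "(g, h) \<in> composable H"
  using assms unfolding theta_mult slice_mult_def by blast

lemma theta_N:
  assumes n: "n \<in> N" and u: "u \<in> \<theta> n" shows "src H u = u" "rng H u = u"
proof -
  have "\<forall>n \<in> N. openin (subtopology (gtop H) (units H)) (\<theta> n)"
    using rep_H unfolding etale_representation_def by (elim conjE)
  then have "openin (subtopology (gtop H) (units H)) (\<theta> n)" using n by blast
  then have "\<theta> n \<subseteq> units H" using openin_subset topspace_subtopology by fastforce
  then show "src H u = u" "rng H u = u" using unitD[OF H] u by blast+
qed

lemma theta_rounded: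
  assumes "h \<in> \<theta> a" obtains b where "b \<lhd> a" "h \<in> \<theta> b"
proof -
  have "\<forall>g \<in> arrows H. \<forall>a. g \<in> \<theta> a \<longrightarrow> (\<exists>b. b \<lhd> a \<and> g \<in> \<theta> b)"
    using rep_H unfolding etale_representation_def by (elim conjE)
  then show thesis using assms theta_arrow[OF assms] that by blast
qed

text \<open>From \<open>a = (as)b\<close> with \<open>as \<in> N\<close>, the slice \<open>\<theta> a\<close> is a restriction of \<open>\<theta> b\<close>.\<close>

lemma theta_up:
  assumes ab: "a \<lhd> b" and h: "h \<in> \<theta> a" shows "h \<in> \<theta> b"
proof -
  obtain s where s: "a \<lhd>\<^bsub>s\<^esub> b" using ab by (rule domE)
  have "h \<in> \<theta> (a * s * b)" using h domv_eqs(1)[OF s] by (simp add: mult.assoc)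
  then obtain g k where gk: "h = gmult H g k" "g \<in> \<theta> (a * s)" "k \<in> \<theta> b" "(g, k) \<in> composable H"
    by (rule theta_multE)
  have "g = rng H k" using theta_N[OF domvD(1)[OF s] gk(2)] gk(4) by (simp add: composable_def)
  then have "h = k" using gk(1) rng_gmult_left[OF H theta_arrow[OF gk(3)]] by simp
  then show ?thesis using gk(3) by simp
qed

text \<open>Writing \<open>h \<in> \<theta> (asb)\<close> as \<open>xyk\<close>, the product \<open>xy \<in> \<theta> (as)\<close> is a unit, so \<open>x\<close> and \<open>h\<close> have the
same range. As both lie in the slice \<open>\<theta> a\<close>, they agree, and \<open>y\<close> is the inverse of \<open>h\<close>.\<close>

lemma theta_inverse:
  assumes s: "a \<lhd>\<^bsub>s\<^esub> b" and h: "h \<in> \<theta> a"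
  shows "ginv H h \<in> \<theta> s" "rng H h \<in> \<theta> (a * s)"
proof -
  have "h \<in> \<theta> (a * s * b)" using h domv_eqs(1)[OF s] by (simp add: mult.assoc)
  then obtain g k where gk: "h = gmult H g k" "g \<in> \<theta> (a * s)" "k \<in> \<theta> b" "(g, k) \<in> composable H"
    by (rule theta_multE)
  obtain x y where xy: "g = gmult H x y" "x \<in> \<theta> a" "y \<in> \<theta> s" "(x, y) \<in> composable H"
    using gk(2) by (rule theta_multE)
  have g: "rng H g = g" by (rule theta_N(2)[OF domvD(1)[OF s] gk(2)])
  have hg: "rng H h = g" using rng_gmult[OF H gk(4)] gk(1) g by simp
  have "rng H x = g" using rng_gmult[OF H xy(4)] xy(1) g by simp
  then have x: "x = h" using theta_rng_inj[OF xy(2) h] hg by simp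
  show "rng H h \<in> \<theta> (a * s)" using hg gk(2) by simp
  have "y = ginv H x" by (rule ginv_unique[OF H xy(4)]) (use xy(1) hg x in simp)
  then show "ginv H h \<in> \<theta> s" using x xy(3) by simp
qed

definition germs :: "'h \<Rightarrow> 'a set" where "germs h = {a. h \<in> \<theta> a}"

lemma Up_germs: "A \<subseteq> germs h \<Longrightarrow> Up A \<subseteq> germs h"
  unfolding germs_def using theta_up by (blast elim: UpE)

lemma Star_germs: "A \<subseteq> germs h \<Longrightarrow> Star A \<subseteq> germs (ginv H h)"
  unfolding germs_def using theta_inverse(1) by (blast elim: StarE)

lemma mult_germs:
  assumes A: "A \<subseteq> germs g" and B: "B \<subseteq> germs h" and c: "src H g = rng H h"
  shows "A * B \<subseteq> germs (gmult H g h)"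
proof
  fix x assume "x \<in> A * B"
  then obtain a b where x: "x = a * b" "a \<in> A" "b \<in> B" by (rule set_times_elim)
  then show "x \<in> germs (gmult H g h)"
    unfolding x(1) germs_def using theta_multI[OF _ _ c] A B by (auto simp: germs_def)
qed

definition unit_germs :: "'h \<Rightarrow> 'a set" where "unit_germs u = N \<inter> germs u"

lemma unit_germs_rounded: "unit_germs u \<subseteq> Up (unit_germs u)"
proof
  fix n assume n: "n \<in> unit_germs u"
  then have "u \<in> \<theta> n" by (simp add: unit_germs_def germs_def)
  then obtain b where b: "b \<lhd> n" "u \<in> \<theta> b" by (rule theta_rounded)
  have "b \<in> N" using dom_N[OF b(1)] n by (simp add: unit_germs_def)
  then show "n \<in> Up (unit_germs u)" using b UpI by (simp add: unit_germs_def germs_def)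
qed

lemma unit_germs_mult:
  assumes n: "n \<in> unit_germs u" and m: "m \<in> unit_germs u" shows "n * m \<in> unit_germs u"
proof -
  have N: "n \<in> N" "m \<in> N" and u: "u \<in> \<theta> n" "u \<in> \<theta> m"
    using n m by (simp_all add: unit_germs_def germs_def)
  have e: "src H u = u" "rng H u = u" by (rule theta_N[OF N(1) u(1)])+
  have "gmult H u u = u" using rng_gmult_left[OF H theta_arrow[OF u(1)]] e by simp
  then have "u \<in> \<theta> (n * m)" using theta_multI[OF u] e by simp
  then show ?thesis using N_mult[OF N] by (simp add: unit_germs_def germs_def)
qed

lemma rng_unit_germ: "a \<lhd>\<^bsub>s\<^esub> b \<Longrightarrow> h \<in> \<theta> a \<Longrightarrow> a * s \<in> unit_germs (rng H h)"
  using theta_inverse(2) domvD(1) by (simp add: unit_germs_def germs_def)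

section \<open>The classifying Zakrzewski morphism\<close>

text \<open>The inclusion \<open>D \<subseteq> germs h\<close> alone would relate \<open>h\<close> to cosets with too many different ranges.
The second condition selects those whose range is as large as the germs in \<open>N\<close> at \<open>rng h\<close> demand.\<close>

definition classifying :: "('a set \<times> 'h) set" where
  "classifying = {(D, h). D \<in> DC \<and> h \<in> arrows H \<and> D \<subseteq> germs h \<and> unit_germs (rng H h) \<subseteq> coset_rng D}"

lemma classifying_iff: "(D, h) \<in> classifying \<longleftrightarrow>
    D \<in> DC \<and> h \<in> arrows H \<and> D \<subseteq> germs h \<and> unit_germs (rng H h) \<subseteq> coset_rng D"
  by (simp add: classifying_def)

text \<open>The unit at \<open>rng h\<close> is determined by \<open>h\<close> alone: elements of \<open>N\<close> are cofinal in the range of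
\<open>D\<close>, and all of them are units at \<open>rng h\<close>.\<close>

lemma classifying_coset_rng:
  assumes "(D, h) \<in> classifying" shows "coset_rng D = Up (unit_germs (rng H h))"
proof
  have D: "D \<in> DC" and h: "h \<in> arrows H" and g: "D \<subseteq> germs h" and u: "unit_germs (rng H h) \<subseteq> coset_rng D"
    using assms by (simp_all add: classifying_iff)
  note cD = directed_cosetD(1)[OF D]
  show "Up (unit_germs (rng H h)) \<subseteq> coset_rng D"
    using Up_mono[OF u] coset_Up[OF directed_cosetD(1)[OF coset_rng_directed[OF D]]] by simp
  have "D * Star D \<subseteq> germs (gmult H h (ginv H h))"
    by (rule mult_germs[OF g Star_germs[OF g]]) (simp add: rng_ginv[OF H h])
  then have cg: "coset_rng D \<subseteq> germs (rng H h)" unfolding coset_rng_def rng_def by (rule Up_germs)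
  show "coset_rng D \<subseteq> Up (unit_germs (rng H h))"
  proof
    fix x assume "x \<in> coset_rng D"
    then have x: "x \<in> coset_src (Star D)" by (simp add: coset_src_Star[OF cD])
    obtain v where v: "v \<in> coset_src (Star D)" "v \<in> N" "v \<lhd> x"
      using coset_Star[OF cD] directed_Star[OF cD directed_cosetD(3)[OF D]] x
        by (rule coset_src_cofinal_N)
    then have "v \<in> unit_germs (rng H h)" using cg by (auto simp: unit_germs_def coset_src_Star[OF cD])
    then show "x \<in> Up (unit_germs (rng H h))" using v(3) by (rule UpI)
  qed
qed

text \<open>The condition at the range transfers to the source by conjugation: if \<open>m \<in> N\<close> is a unit germ
at \<open>src h\<close>, then \<open>dms\<close> is one at \<open>rng h\<close>, hence in the range of \<open>D\<close>, and \<open>s(dms)d = (sd)m(sd)\<close> is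
below everything above \<open>m\<close>.\<close>

lemma classifying_ginv:
  assumes "(D, h) \<in> classifying" shows "(Star D, ginv H h) \<in> classifying"
proof -
  have D: "D \<in> DC" and h: "h \<in> arrows H" and g: "D \<subseteq> germs h" and u: "unit_germs (rng H h) \<subseteq> coset_rng D"
    using assms by (simp_all add: classifying_iff)
  note cD = directed_cosetD(1)[OF D]
  have "n \<in> coset_src D" if n: "n \<in> unit_germs (src H h)" for n
  proof -
    obtain m where m: "m \<in> unit_germs (src H h)" "m \<lhd> n" using n unit_germs_rounded by (blast elim: UpE)
    have mN: "m \<in> N" and mg: "m \<in> germs (src H h)" using m(1) by (simp_all add: unit_germs_def)
    obtain c where c: "c \<in> D" using directed_cosetD(2)[OF D] by blast
    obtain d s where d: "d \<in> D" "d \<lhd>\<^bsub>s\<^esub> c" using cD c by (rule coset_below)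
    have s: "s \<in> Star D" by (rule StarI[OF d])
    have "{d} * {m} * {s} \<subseteq> germs (gmult H (gmult H h (src H h)) (ginv H h))"
    proof (intro mult_germs)
      show "{d} \<subseteq> germs h" using d(1) g by blast
      show "{m} \<subseteq> germs (src H h)" using mg by blast
      show "{s} \<subseteq> germs (ginv H h)" using s Star_germs[OF g] by blast
      show "src H h = rng H (src H h)" by (simp add: rng_src[OF H h])
      show "src H (gmult H h (src H h)) = rng H (ginv H h)"
        by (simp add: gmult_src_right[OF H h] rng_ginv[OF H h])
    qed
    then have "d * m * s \<in> germs (rng H h)"
      by (simp add: gmult_src_right[OF H h] rng_def set_times_def)
    moreover have "d * m * s \<in> N" by (rule domvD(1)[OF domv_mult_N_right[OF d(2) mN]])
    ultimately have "d * m * s \<in> coset_rng D" using u by (auto simp: unit_germs_def)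
    then have "d * m * s * d \<in> D" using coset_rng_mult_subset[OF cD] set_times_intro[OF _ d(1)] by blast
    then have "s * (d * m * s * d) \<in> Star D * D" by (rule set_times_intro[OF s])
    moreover have "s * d * m * (s * d) \<lhd> n"
      by (intro dom_mult_N_right dom_mult_N_left m(2) domvD(2)[OF d(2)])
    ultimately show "n \<in> coset_src D" unfolding coset_src_def using UpI by (simp add: mult.assoc)
  qed
  then show ?thesis
    using directed_coset_Star[OF D] ginv_arrow[OF H h] Star_germs[OF g]
    by (auto simp: classifying_iff rng_ginv[OF H h] coset_rng_Star[OF cD])
qed

lemma classifying_mult:
  assumes Dg: "(D, g) \<in> classifying" and Eh: "(E, h) \<in> classifying" and c: "src H g = rng H h"
  shows "coset_src D = coset_rng E" "(Up (D * E), gmult H g h) \<in> classifying"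
proof -
  have D: "D \<in> DC" "g \<in> arrows H" "D \<subseteq> germs g" "unit_germs (rng H g) \<subseteq> coset_rng D"
    and E: "E \<in> DC" "h \<in> arrows H" "E \<subseteq> germs h"
    using Dg Eh by (simp_all add: classifying_iff)
  have comp: "(g, h) \<in> composable H" using D E c by (simp add: composable_def)
  have "coset_src D = Up (unit_germs (rng H h))"
    using classifying_coset_rng[OF classifying_ginv[OF Dg]] c
      by (simp add: coset_rng_Star directed_cosetD(1)[OF D(1)] rng_ginv[OF H D(2)])
  then show eq: "coset_src D = coset_rng E" using classifying_coset_rng[OF Eh] by simp
  show "(Up (D * E), gmult H g h) \<in> classifying"
    unfolding classifying_iff rng_gmult[OF H comp] coset_rng_mult_eq[OF directed_cosetD(1)[OF D(1)] directed_cosetD(1)[OF E(1)] eq]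
    by (intro conjI directed_coset_mult D E eq gmult_arrow[OF H comp] Up_germs mult_germs c)
qed

lemma classifying_functorial: "functorial DG H classifying"
  unfolding functorial_def DG_simps src_DG rng_DG
  using classifying_ginv classifying_mult by (auto simp: classifying_iff)

text \<open>Each \<open>d \<in> D\<close> provides an arrow of \<open>\<theta> d\<close> with range \<open>u\<close>. Directedness of \<open>D\<close> and injectivity
of the range map on slices show that all these arrows coincide.\<close>

lemma classifying_star_bijective: "star_bijective DG H classifying"
  unfolding star_bijective_def DG_simps rng_DG
proof (intro ballI impI)
  fix D u assume D: "D \<in> DC" and u: "u \<in> units H" and "(coset_rng D, u) \<in> classifying"
  note cD = directed_cosetD(1)[OF D]
  have coset_rng2: "coset_rng (coset_rng D) = coset_rng D"
    using coset_rng_coset_src[OF coset_Star[OF cD]] by (simp add: coset_src_Star[OF cD])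
  have g: "coset_rng D \<subseteq> germs u" and ug: "unit_germs u \<subseteq> coset_rng D"
    using \<open>(coset_rng D, u) \<in> classifying\<close> unitD[OF H u] by (simp_all add: classifying_iff coset_rng2)
  obtain a where a: "a \<in> D" using directed_cosetD(2)[OF D] by blast
  have ex: "\<exists>i. i \<in> \<theta> d \<and> rng H i = u" if d: "d \<in> D" for d
  proof -
    obtain e s where e: "e \<in> D" "e \<lhd>\<^bsub>s\<^esub> d" using cD d by (rule coset_below)
    have "e * s \<in> coset_rng D"
      using mult_Star_subset_coset_rng[OF cD] set_times_intro[OF e(1) StarI[OF e]] by blast
    then have "u \<in> \<theta> (e * s)" using g by (auto simp: germs_def)
    then obtain i j where ij: "u = gmult H i j" "i \<in> \<theta> e" "(i, j) \<in> composable H"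
      by (rule theta_multE)
    then have "rng H i = u" using rng_gmult[OF H ij(3)] unitD[OF H u] by simp
    then show ?thesis using theta_up[OF domI[OF e(2)] ij(2)] by blast
  qed
  obtain i where i: "i \<in> \<theta> a" "rng H i = u" using ex[OF a] by blast
  have "D \<subseteq> germs i"
  proof
    fix b assume b: "b \<in> D"
    obtain d where d: "d \<in> D" "d \<lhd> a" "d \<lhd> b" using directed_cosetD(3)[OF D] a b by (rule directedE)
    obtain j where j: "j \<in> \<theta> d" "rng H j = u" using ex[OF d(1)] by blast
    have "j = i" using theta_rng_inj[OF theta_up[OF d(2) j(1)] i(1)] i(2) j(2) by simp
    then show "b \<in> germs i" using theta_up[OF d(3) j(1)] by (simp add: germs_def)
  qed
  then have classifying: "(D, i) \<in> classifying" using D ug i theta_arrow by (simp add: classifying_iff)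
  show "\<exists>!i. i \<in> arrows H \<and> rng H i = u \<and> (D, i) \<in> classifying"
  proof (intro ex1I conjI)
    show "i \<in> arrows H" "rng H i = u" "(D, i) \<in> classifying" using i theta_arrow classifying by simp_all
    fix j assume "j \<in> arrows H \<and> rng H j = u \<and> (D, j) \<in> classifying"
    then have "j \<in> \<theta> a" "rng H j = u" using a by (auto simp: classifying_iff germs_def)
    then show "j = i" using theta_rng_inj i by simp
  qed
qed

text \<open>The upward closure of \<open>F\<close> itself is directed, but it need not be a coset: in the additive
group of integers with \<open>N\<close> the naturals and \<open>Z = {0}\<close>, the upward closure of \<open>{0}\<close> is the set of
non-positive integers. Multiplying \<open>F\<close> by all unit germs at \<open>rng h\<close> supplies the missing elements.
Whenever a product has to be moved past an element of \<open>F\<close>, a factor \<open>gt\<close> with \<open>g <\<^sub>t g\<^sub>1\<close> is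
inserted, which is a unit germ as well.\<close>

lemma directed_germs_generate:
  assumes h: "h \<in> arrows H" and F: "Directed F" "F \<noteq> {}" and Fg: "F \<subseteq> germs h"
  defines "D \<equiv> Up (unit_germs (rng H h) * F)"
  shows "(D, h) \<in> classifying" "F \<subseteq> D"
proof -
  let ?L = "unit_germs (rng H h)" let ?K = "?L * F"
  have LN: "n \<in> N" if "n \<in> ?L" for n using that by (simp add: unit_germs_def)
  have Lr: "\<exists>m \<in> ?L. m \<lhd> n" if "n \<in> ?L" for n using that unit_germs_rounded by (blast elim: UpE)
  have KI: "n * f \<in> ?K" if "n \<in> ?L" "f \<in> F" for n f using that by (rule set_times_intro)
  have KE: "\<exists>n \<in> ?L. \<exists>f \<in> F. x = n * f" if "x \<in> ?K" for x using that by (blast elim: set_times_elim)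
  have "?L * F \<subseteq> germs (gmult H (rng H h) h)"
    by (rule mult_germs[OF _ Fg]) (simp_all add: unit_germs_def src_rng[OF H h])
  then have Kg: "?K \<subseteq> germs h" by (simp add: rng_gmult_left[OF H h])
  have L1: "f * s \<in> ?L" if "f \<in> germs h" "f \<lhd>\<^bsub>s\<^esub> b" for f s b
    using that rng_unit_germ by (simp add: germs_def)
  have dirK: "Directed ?K"
    unfolding directed_def
  proof (intro ballI)
    fix x y assume "x \<in> ?K" "y \<in> ?K"
    then obtain n f m f' where x: "x = n * f" "n \<in> ?L" "f \<in> F" and y: "y = m * f'" "m \<in> ?L" "f' \<in> F"
      using KE by meson
    obtain n' where n': "n' \<in> ?L" "n' \<lhd> n" using Lr[OF x(2)] by blast
    obtain m' where m': "m' \<in> ?L" "m' \<lhd> m" using Lr[OF y(2)] by blast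
    obtain g1 where g1: "g1 \<in> F" "g1 \<lhd> f" "g1 \<lhd> f'" using F(1) x(3) y(3) by (rule directedE)
    obtain g where g: "g \<in> F" "g \<lhd> g1" using F(1) g1(1) by (blast elim: directedE)
    obtain t where t: "g \<lhd>\<^bsub>t\<^esub> g1" using g(2) by (rule domE)
    have gt: "g * t \<in> ?L" using L1[OF _ t] g(1) Fg by blast
    \<comment> \<open>The bound \<open>n'(gt)m'g\<close> of \<open>nf\<close> and \<open>mf'\<close>: read as \<open>n'g \<cdot> tm'g\<close> it is below the first, read as
    \<open>n'gt \<cdot> m'g\<close> below the second.\<close>
    have "n' * (g * t) * m' * g \<in> ?K" by (intro KI unit_germs_mult n' gt m' g)
    moreover have "n' * (g * t) * m' * g \<lhd> x"
    proof -
      have "t * (m' * g) \<in> N" by (rule domvD(2)[OF domv_mult_N_left[OF t LN[OF m'(1)]]])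
      then have "n' * (g * (t * (m' * g))) \<lhd> n * f"
        by (intro dom_mult n' dom_mult_N_right dom_trans[OF g(2) g1(2)])
      then show ?thesis by (simp add: x(1) mult.assoc)
    qed
    moreover have "n' * (g * t) * m' * g \<lhd> y"
    proof -
      have "n' * (g * t) * (m' * g) \<lhd> m * f'"
        by (intro dom_mult_N_left dom_mult m' dom_trans[OF g(2) g1(3)] LN unit_germs_mult n' gt)
      then show ?thesis by (simp add: y(1) mult.assoc)
    qed
    ultimately show "\<exists>d \<in> ?K. d \<lhd> x \<and> d \<lhd> y" by blast
  qed
  note rK = directed_rounded[OF dirK]
  have KD: "?K \<subseteq> D" unfolding D_def by (rule rK)
  show FD: "F \<subseteq> D"
  proof
    fix a assume "a \<in> F"
    then obtain f where f: "f \<in> F" "f \<lhd> a" using F(1) by (blast elim: directedE)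
    obtain s where s: "f \<lhd>\<^bsub>s\<^esub> a" using f(2) by (rule domE)
    have "f * s \<in> ?L" using L1[OF _ s] f(1) Fg by blast
    then have "f * s * f \<in> ?K" "f * s * f \<lhd> a" using KI f LN dom_mult_N_left by blast+
    then show "a \<in> D" unfolding D_def by (rule UpI)
  qed
  have cD: "Coset D"
    unfolding coset_def
  proof
    show "D = Up D" unfolding D_def by (simp add: Up_Up[OF rK])
    show "D * Star D * D \<subseteq> D"
    proof
      fix x assume "x \<in> D * Star D * D"
      then obtain c s d where x: "x = c * s * d" "c \<in> D" "s \<in> Star D" "d \<in> D"
        by (elim set_times_elim) blast
      obtain k1 where k1: "k1 \<in> ?K" "k1 \<lhd> c" using x(2) unfolding D_def by (rule UpE)
      obtain k2 where k2: "k2 \<in> ?K" "k2 \<lhd> d" using x(4) unfolding D_def by (rule UpE)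
      obtain e b where e: "e \<in> D" "e \<lhd>\<^bsub>s\<^esub> b" using x(3) by (rule StarE)
      obtain k where k: "k \<in> ?K" "k \<lhd> e" using e(1) unfolding D_def by (rule UpE)
      have kb: "k \<lhd>\<^bsub>s\<^esub> b" by (rule dom_via_trans[OF k(2) e(2)])
      obtain n f where nf: "k = n * f" "n \<in> ?L" "f \<in> F" using KE[OF k(1)] by blast
      obtain n1 f1 where nf1: "k1 = n1 * f1" "n1 \<in> ?L" "f1 \<in> F" using KE[OF k1(1)] by blast
      obtain n2 f2 where nf2: "k2 = n2 * f2" "n2 \<in> ?L" "f2 \<in> F" using KE[OF k2(1)] by blast
      obtain n' where n': "n' \<in> ?L" "n' \<lhd> n" using Lr[OF nf(2)] by blast
      obtain n1' where n1': "n1' \<in> ?L" "n1' \<lhd> n1" using Lr[OF nf1(2)] by blast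
      obtain g1 where g1: "g1 \<in> F" "g1 \<lhd> f" "g1 \<lhd> f1" using F(1) nf(3) nf1(3) by (rule directedE)
      obtain g where g: "g \<in> F" "g \<lhd> g1" using F(1) g1(1) by (blast elim: directedE)
      obtain t where t: "g \<lhd>\<^bsub>t\<^esub> g1" using g(2) by (rule domE)
      have gt: "g * t \<in> ?L" using L1[OF _ t] g(1) Fg by blast
      have "n' * g \<lhd> k" unfolding nf(1) by (intro dom_mult n' dom_trans[OF g(2) g1(2)])
      then obtain r where r: "n' * g \<lhd>\<^bsub>r\<^esub> k" by (rule domE)
      define s0 where "s0 = s * (k * r)"
      have s0: "n' * g \<lhd>\<^bsub>s0\<^esub> b" "s0 \<lhd> s"
        unfolding s0_def using domv_interpolate[OF r kb] domI by blast+
      have k's: "n' * g * s0 \<in> ?L" by (rule L1[OF _ s0(1)]) (use Kg KI n'(1) g(1) in blast)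
      \<comment> \<open>Below \<open>csd\<close>: bound \<open>c\<close> by \<open>n1'g(tn'g)\<close> with the inserted factor \<open>tn'g \<in> N\<close>, and \<open>s\<close> by
      \<open>s0\<close>. Then \<open>n'g \<cdot> s0\<close> is a unit germ.\<close>
      have "t * (n' * g) \<in> N" by (rule domvD(2)[OF domv_mult_N_left[OF t LN[OF n'(1)]]])
      then have "n1' * (g * (t * (n' * g))) \<lhd> k1"
        unfolding nf1(1) by (intro dom_mult n1' dom_mult_N_right dom_trans[OF g(2) g1(3)])
      then have "n1' * (g * (t * (n' * g))) * s0 * k2 \<lhd> x"
        unfolding x(1) by (intro dom_mult dom_trans[OF _ k1(2)] s0 k2)
      moreover have "n1' * (g * t) * (n' * g * s0) * n2 * f2 \<in> ?K"
        by (intro KI unit_germs_mult n1' gt k's nf2)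
      ultimately show "x \<in> D" unfolding D_def using UpI by (simp add: nf2(1) mult.assoc)
    qed
  qed
  have D: "D \<in> DC"
    using directed_cosetI[OF cD] FD F(2) directed_Up[OF dirK] unfolding D_def by blast
  have "?L \<subseteq> coset_rng D"
  proof
    fix n assume "n \<in> ?L"
    then obtain m where m: "m \<in> ?L" "m \<lhd> n" using Lr by blast
    obtain f where "f \<in> F" using F(2) by blast
    then obtain f' where f': "f' \<in> F" "f' \<lhd> f" using F(1) by (blast elim: directedE)
    obtain s where s: "f' \<lhd>\<^bsub>s\<^esub> f" using f'(2) by (rule domE)
    have k: "m * f' \<in> D" using KD KI[OF m(1) f'(1)] by blast
    have "s \<in> Star D" using StarI[OF k domv_mult_N_left[OF s LN[OF m(1)]]] .
    then have "m * f' * s \<in> D * Star D" by (rule set_times_intro[OF k])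
    moreover have "m * (f' * s) \<lhd> n" by (rule dom_mult_N_right[OF m(2) domvD(1)[OF s]])
    ultimately show "n \<in> coset_rng D" unfolding coset_rng_def using UpI by (simp add: mult.assoc)
  qed
  moreover have "D \<subseteq> germs h" unfolding D_def by (rule Up_germs[OF Kg])
  ultimately show "(D, h) \<in> classifying" using D h by (simp add: classifying_iff)
qed

text \<open>A descending sequence of elements around \<open>h\<close>, starting at \<open>a\<close>, is a directed set of germs.\<close>

lemma classifying_exists:
  assumes h: "h \<in> \<theta> a"
  obtains D where "(D, h) \<in> classifying" "a \<in> D"
proof -
  have "\<exists>f. \<forall>n::nat. (h \<in> \<theta> (f n) \<and> (n = 0 \<longrightarrow> f n = a)) \<and> f (Suc n) \<lhd> f n"
  proof (rule dependent_nat_choice)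
    show "\<exists>x. h \<in> \<theta> x \<and> (0 = (0::nat) \<longrightarrow> x = a)" using h by blast
    fix x and n :: nat assume "h \<in> \<theta> x \<and> (n = 0 \<longrightarrow> x = a)"
    then obtain y where "y \<lhd> x" "h \<in> \<theta> y" using theta_rounded by blast
    then show "\<exists>y. (h \<in> \<theta> y \<and> (Suc n = 0 \<longrightarrow> y = a)) \<and> y \<lhd> x" by blast
  qed
  then obtain f where f: "\<And>n::nat. h \<in> \<theta> (f n)" "f 0 = a" "\<And>n. f (Suc n) \<lhd> f n" by blast
  have dec: "f n \<lhd> f m" if "m < n" for m n
    using that
  proof (induction n)
    case (Suc n)
    then show ?case using f(3)[of n] dom_trans by (cases "m = n") auto
  qed simp
  have "Directed (range f)"
    unfolding directed_def
  proof (intro ballI)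
    fix x y assume "x \<in> range f" "y \<in> range f"
    then obtain i j where ij: "x = f i" "y = f j" by blast
    have "f (Suc (max i j)) \<lhd> x" "f (Suc (max i j)) \<lhd> y" unfolding ij by (intro dec; simp)+
    then show "\<exists>d \<in> range f. d \<lhd> x \<and> d \<lhd> y" by blast
  qed
  moreover have "range f \<subseteq> germs h" using f(1) by (auto simp: germs_def)
  ultimately have "(Up (unit_germs (rng H h) * range f), h) \<in> classifying"
    "range f \<subseteq> Up (unit_germs (rng H h) * range f)"
    using directed_germs_generate[OF theta_arrow[OF h]] by blast+
  moreover have "a \<in> range f" using f(2) by (metis rangeI)
  ultimately show thesis using that by blast
qed

lemma classifying_rep: "classifying `` rep a = \<theta> a"
proof
  show "classifying `` rep a \<subseteq> \<theta> a" by (auto simp: mem_rep classifying_iff germs_def)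
  show "\<theta> a \<subseteq> classifying `` rep a"
  proof
    fix h assume "h \<in> \<theta> a"
    then obtain D where "(D, h) \<in> classifying" "a \<in> D" by (rule classifying_exists)
    then show "h \<in> classifying `` rep a" by (auto simp: mem_rep classifying_iff)
  qed
qed

lemma classifying_zakrzewski: "zakrzewski_morphism DG H classifying"
  unfolding zakrzewski_morphism_def
proof (intro conjI allI impI)
  show "functorial DG H classifying" by (rule classifying_functorial)
  show "star_bijective DG H classifying" by (rule classifying_star_bijective)
  fix U assume U: "openin (gtop DG) U"
  have "classifying `` U = (\<Union>a \<in> {a. rep a \<subseteq> U}. \<theta> a)"
  proof
    show "classifying `` U \<subseteq> (\<Union>a \<in> {a. rep a \<subseteq> U}. \<theta> a)"
    proof
      fix h assume "h \<in> classifying `` U"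
      then obtain D where D: "D \<in> U" "(D, h) \<in> classifying" by blast
      then obtain a where a: "a \<in> D" "rep a \<subseteq> U" using U by (auto simp: openin_DG)
      have "h \<in> \<theta> a" using D(2) a(1) by (auto simp: classifying_iff germs_def)
      then show "h \<in> (\<Union>a \<in> {a. rep a \<subseteq> U}. \<theta> a)" using a(2) by blast
    qed
    show "(\<Union>a \<in> {a. rep a \<subseteq> U}. \<theta> a) \<subseteq> classifying `` U"
    proof
      fix h assume "h \<in> (\<Union>a \<in> {a. rep a \<subseteq> U}. \<theta> a)"
      then obtain a where a: "rep a \<subseteq> U" "h \<in> \<theta> a" by blast
      then have "h \<in> classifying `` rep a" by (simp add: classifying_rep)
      then show "h \<in> classifying `` U" using a(1) by blast
    qed
  qed
  then show "openin (gtop H) (classifying `` U)" using theta_open by auto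
qed

text \<open>For \<open>n\<close> a unit germ at \<open>rng h\<close>, the morphism \<open>\<psi>\<close> relates some \<open>E\<close> containing \<open>n\<close> to \<open>rng h\<close>.
As \<open>n \<in> N\<close>, this \<open>E\<close> is a unit, and functoriality identifies it with the range of \<open>D\<close>. So \<open>\<psi>\<close> is
contained in the classifying relation. Conversely, if \<open>D\<close> is related to \<open>h\<close> and \<open>a \<in> D\<close>, then \<open>\<psi>\<close>
relates some \<open>E\<close> containing \<open>a\<close> to \<open>h\<close>, which has the same range as \<open>D\<close>, so that \<open>E = D\<close>.\<close>

lemma classifying_unique:
  assumes zak: "zakrzewski_morphism DG H \<psi>" and \<psi>: "\<And>a. \<psi> `` rep a = \<theta> a"
  shows "\<psi> = classifying"
proof -
  have funct: "functorial DG H \<psi>" using zak by (simp add: zakrzewski_morphism_def)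
  have arr: "D \<in> DC \<and> h \<in> arrows H" if "(D, h) \<in> \<psi>" for D h
    using funct that unfolding functorial_def by auto
  have inv: "(Star D, ginv H h) \<in> \<psi>" if "(D, h) \<in> \<psi>" for D h
    using funct that unfolding functorial_def by auto
  have mul: "coset_src D = coset_rng E \<and> (Up (D * E), gmult H g h) \<in> \<psi>"
    if "(D, g) \<in> \<psi>" "(E, h) \<in> \<psi>" "src H g = rng H h" for D E g h
    using funct that unfolding functorial_def DG_simps src_DG rng_DG by blast
  have sub: "(D, h) \<in> classifying" if Dh: "(D, h) \<in> \<psi>" for D h
  proof -
    have D: "D \<in> DC" and h: "h \<in> arrows H" using arr[OF Dh] by simp_all
    note cD = directed_cosetD(1)[OF D]
    have "D \<subseteq> germs h"
    proof
      fix a assume "a \<in> D"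
      then have "D \<in> rep a" using D by (simp add: mem_rep)
      then have "h \<in> \<psi> `` rep a" using Dh by blast
      then show "a \<in> germs h" by (simp add: \<psi> germs_def)
    qed
    moreover have "n \<in> coset_rng D" if n: "n \<in> unit_germs (rng H h)" for n
    proof -
      have nN: "n \<in> N" and "rng H h \<in> \<theta> n" using n by (simp_all add: unit_germs_def germs_def)
      then obtain E where E: "E \<in> rep n" "(E, rng H h) \<in> \<psi>" using \<psi>[of n] by blast
      have EE: "E \<in> DC" "n \<in> E" using E(1) by (simp_all add: mem_rep)
      have unitE: "coset_src E = E" by (rule N_mem_unit[OF EE nN])
      have "src H h = rng H (ginv H h)" by (simp add: rng_ginv[OF H h])
      then have "(coset_rng D, rng H h) \<in> \<psi>"
        using mul[OF Dh inv[OF Dh]] by (simp add: coset_rng_def rng_def)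
      moreover have "src H (rng H h) = rng H (rng H h)" by (simp add: src_rng[OF H h] rng_rng[OF H h])
      ultimately have "coset_src E = coset_rng (coset_rng D)" using mul[OF E(2)] by blast
      then have "E = coset_rng D"
        using coset_rng_coset_src[OF coset_Star[OF cD]] unitE by (simp add: coset_src_Star[OF cD])
      then show ?thesis using EE(2) by simp
    qed
    ultimately show ?thesis using D h by (auto simp: classifying_iff)
  qed
  have sup: "(D, h) \<in> \<psi>" if Dh: "(D, h) \<in> classifying" for D h
  proof -
    have D: "D \<in> DC" and g: "D \<subseteq> germs h" using Dh by (simp_all add: classifying_iff)
    obtain a where a: "a \<in> D" using directed_cosetD(2)[OF D] by blast
    then have "h \<in> \<theta> a" using g by (auto simp: germs_def)
    then obtain E where E: "E \<in> rep a" "(E, h) \<in> \<psi>" using \<psi>[of a] by blast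
    have "coset_rng D = coset_rng E" using classifying_coset_rng[OF Dh] classifying_coset_rng[OF sub[OF E(2)]] by simp
    moreover have "D \<in> rep a" using D a by (simp add: mem_rep)
    ultimately have "D = E" using slice_rep[of a] E(1) by (auto simp: slice_def inj_on_def rng_DG)
    then show ?thesis using E(2) by simp
  qed
  show ?thesis using sub sup by auto
qed

end

section \<open>Universality\<close>

theorem theorem11p15:
  fixes N Z :: "'a::semigroup_mult set"
  assumes "structured_semigroup N Z" and "symmetric Z"
  shows "zakrzewski_universal TYPE('h) N Z
    (directed_coset_groupoid N Z) (directed_coset_rep N Z)"
  unfolding zakrzewski_universal_def
proof (intro conjI allI impI)
  interpret structured N Z by unfold_locales (rule assms(1))
  show "etale_representation N Z DG rep" by (rule etale_representation_rep[OF assms(2)])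
  fix H :: "'h top_groupoid" and \<theta>
  assume "etale_representation N Z H \<theta>"
  then interpret etale_rep N Z H \<theta> by unfold_locales
  show "\<exists>!\<phi>. zakrzewski_morphism DG H \<phi> \<and> \<theta> = (\<lambda>U. \<phi> `` U) \<circ> rep"
  proof (intro ex1I conjI)
    show "zakrzewski_morphism DG H classifying" by (rule classifying_zakrzewski)
    show "\<theta> = (\<lambda>U. classifying `` U) \<circ> rep" by (rule ext) (simp add: classifying_rep)
    fix \<psi> assume "zakrzewski_morphism DG H \<psi> \<and> \<theta> = (\<lambda>U. \<psi> `` U) \<circ> rep"
    then show "\<psi> = classifying" by (intro classifying_unique) auto
  qed
qed

end
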